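(* Suppose that $1\le r\le n$. As $n\to\infty$, the average depth of node $r$ over all noncrossing trees with $n$ edges is asymptotically equal to $$\begin{cases} 2r-6\displaystyle\sum_{i=1}^{r-1}(r-i)\,t'_{i-1}\,\frac{4^i}{27^i} & \text{if $r$ is fixed},\\[3mm] \displaystyle\frac{8}{\sqrt{3\pi}}\sqrt{r\left(1-\frac{r}{n}\right)} & \text{if $r=r(n)$ is such that $r\to\infty$ and $n-r\to\infty$}, \end{cases}$$ where $t'_k=\frac{1}{k+1}\binom{3k+1}{k}$ for $k\ge 0$.
   Context: A noncrossing tree with $n$ edges is a tree whose $n+1$ nodes are points on the boundary of a circle, labeled $0,1,\dots,n$ in counterclockwise order around the circle, and whose edges are straight segments that do not cross. It is regarded as rooted at node $0$. The depth of a node is the number of edges in the path from node $0$ to it. The number of noncrossing trees with $n$ edges is $\frac{1}{2n+1}\binom{3n}{n}$, and averages are over the uniform distribution on these. (The number $t'_k$ is the coefficient of $z^k$ in $T(z)^2$, where $T(z)=\sum_{n\ge0}\frac{1}{2n+1}\binom{3n}{n}z^n$.) For fixed $r$, "asymptotically equal" means that the average converges to the displayed constant; when $r=r(n)$ varies, it means that the ratio of the two quantities tends to $1$. *)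

theory Defs
  imports "HOL-Analysis.Analysis" "HOL-Library.Landau_Symbols"
begin

section \<open>Undirected simple graphs and trees\<close>

text \<open>
  A simple graph is given by its vertex set \<open>V\<close> and its edge set \<open>E\<close>, a set of two-element subsets
  of \<open>V\<close>.  Paths and cycles are lists of distinct vertices; in a cycle the closing edge joins the
  last vertex to the first.
\<close>

definition simple_graph :: "'a set \<Rightarrow> 'a set set \<Rightarrow> bool" where
  "simple_graph V E \<longleftrightarrow> (\<forall>e\<in>E. e \<subseteq> V \<and> card e = 2)"

definition path_in :: "'a set set \<Rightarrow> 'a list \<Rightarrow> bool" where
  "path_in E p \<longleftrightarrow> p \<noteq> [] \<and> distinct p \<and> successively (\<lambda>u v. {u, v} \<in> E) p"

definition path_between :: "'a set set \<Rightarrow> 'a \<Rightarrow> 'a \<Rightarrow> 'a list \<Rightarrow> bool" where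
  "path_between E u v p \<longleftrightarrow> path_in E p \<and> hd p = u \<and> last p = v"

definition cycle_in :: "'a set set \<Rightarrow> 'a list \<Rightarrow> bool" where
  "cycle_in E p \<longleftrightarrow> path_in E p \<and> length p \<ge> 3 \<and> {last p, hd p} \<in> E"

definition tree_on :: "'a set \<Rightarrow> 'a set set \<Rightarrow> bool" where
  "tree_on V E \<longleftrightarrow> V \<noteq> {} \<and> simple_graph V E \<and>
     (\<forall>u\<in>V. \<forall>v\<in>V. \<exists>p. path_between E u v p) \<and> \<not> (\<exists>p. cycle_in E p)"


section \<open>Noncrossing trees\<close>

text \<open>
  The \<open>n + 1\<close> nodes are placed at the vertices of a regular polygon inscribed in the unit circle,
  counterclockwise, with node 0 at the point 1.
\<close>

definition node_point :: "nat \<Rightarrow> nat \<Rightarrow> complex" where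
  "node_point n k = cis (2 * pi * real k / real (n + 1))"

text \<open>
  As no node lies in the relative interior of a chord, two distinct edges can only meet in a common
  end point or in an interior point of both; the latter is what noncrossing rules out.
\<close>

definition noncrossing :: "nat \<Rightarrow> nat set set \<Rightarrow> bool" where
  "noncrossing n E \<longleftrightarrow>
     (\<forall>a b c d. {a, b} \<in> E \<and> {c, d} \<in> E \<and> {a, b} \<noteq> {c, d} \<longrightarrow>
        open_segment (node_point n a) (node_point n b) \<inter>
        open_segment (node_point n c) (node_point n d) = {})"

definition noncrossing_trees :: "nat \<Rightarrow> nat set set set" where
  "noncrossing_trees n = {E. tree_on {0..n} E \<and> noncrossing n E}"

text \<open>Path lists contain vertices, so a path has one edge fewer than its list has entries.\<close>

definition depth :: "nat set set \<Rightarrow> nat \<Rightarrow> nat" where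
  "depth E v = length (THE p. path_between E 0 v p) - 1"

definition average_depth :: "nat \<Rightarrow> nat \<Rightarrow> real" where
  "average_depth n r =
     (\<Sum>E\<in>noncrossing_trees n. real (depth E r)) / real (card (noncrossing_trees n))"

definition t' :: "nat \<Rightarrow> real" where
  "t' k = real ((3 * k + 1) choose k) / real (k + 1)"

end

theory Submission
  imports Defs "HOL-Real_Asymp.Real_Asymp"
begin

text \<open>
  The distance of two nodes of a tree is the number of edges whose deletion separates them. Let \<open>S(r)\<close> be the
  sum of the depths of node \<open>r\<close> over all noncrossing trees with \<open>n\<close> edges, with \<open>S(0) = S(n + 1) = 0\<close>, and let
  \<open>d\<close> denote distances. Rotating the circle permutes the trees, so \<open>S(r)\<close> and \<open>S(r + 1)\<close> are also the
  sums of \<open>d(n, r - 1)\<close> and \<open>d(n, r)\<close>. Therefore \<open>S(r + 1) - 2 S(r) + S(r - 1)\<close> is the sum of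
  \<open>d(n, r) + d(0, r - 1) - d(0, r) - d(n, r - 1)\<close>, where \<open>n, 0\<close> and \<open>r - 1, r\<close> are pairs of neighbours on the circle.
  An edge contributes to this only if its deletion separates both pairs. In a noncrossing tree
  the two components are then the arcs \<open>{0..r - 1}\<close> and \<open>{r..n}\<close>, and the contribution is \<open>-2\<close>
  (\<open>cut_iff_ends\<close>, \<open>dist_in_second_difference\<close>).

  So the second difference counts trees with a marked edge that splits the circle into two given arcs. Without
  the edge, two noncrossing trees remain, each with a marked vertex that no edge passes over, and such a vertex
  divides its tree into two trees glued there. If \<open>T\<close> is the generating function of noncrossing trees,
  each of the two parts is thus counted by \<open>T\<^sup>2\<close>, whose coefficients are \<open>t'\<^bsub>k\<^esub>\<close>, and
  \<open>S(r + 1) - 2 S(r) + S(r - 1) = - 2 t'\<^bsub>r-1\<^esub> t'\<^bsub>n-r\<^esub>\<close> (\<open>total_depth_rec\<close>). Cutting a tree at the largest neighbour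
  of the root, and then at the edge that leads there, gives \<open>T = 1 + z T\<^sup>3\<close> (\<open>T_fps_eq\<close>), from which the
  coefficients of all powers of \<open>T\<close> follow.

  Solving the recursion with the boundary values gives \<open>S(1) = t'\<^bsub>n\<^esub> - t\<^bsub>n\<^esub>\<close>, for the number \<open>t\<^bsub>n\<^esub>\<close> of trees, and a
  finite sum for \<open>S(r)\<close>; for fixed \<open>r\<close> the limits of \<open>t'\<^bsub>n-i\<^esub> / t\<^bsub>n\<^esub>\<close> suffice (\<open>average_depth_fixed\<close>).

  For the other case, \<open>t\<^bsub>n\<^esub>\<close> is of order \<open>(27/4)\<^sup>n n powr (-3/2)\<close>, so the negative second difference of the
  average depth is asymptotically a constant times \<open>(N / (i (N - i))) powr (3/2)\<close>, with \<open>N = n + 1\<close>, when \<open>i\<close> and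
  \<open>N - i\<close> are large. The function \<open>sqrt (i (N - i) / N)\<close> behaves in the same way
  (\<open>sqrt_second_difference\<close>), and it has the same zeros. A discrete maximum principle turns the
  agreement of second differences into that of the functions, up to a constant due to the ends of
  the interval (\<open>second_difference_comparison\<close>), and this constant is negligible as soon as \<open>r\<close> and \<open>n - r\<close>
  tend to infinity.
\<close>

section \<open>Connectivity, bridges and distance\<close>

definition conn :: "'a set set \<Rightarrow> 'a \<Rightarrow> 'a \<Rightarrow> bool" where
  "conn E = (\<lambda>x y. {x, y} \<in> E)\<^sup>*\<^sup>*"

lemma conn_refl [simp, intro]: "conn E u u"
  by (simp add: conn_def)

lemma conn_edge: "{u, v} \<in> E \<Longrightarrow> conn E u v"
  unfolding conn_def by (rule r_into_rtranclp)

lemma conn_trans [trans]: "conn E u v \<Longrightarrow> conn E v w \<Longrightarrow> conn E u w"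
  unfolding conn_def by (rule rtranclp_trans)

lemma conn_sym: "conn E u v \<Longrightarrow> conn E v u"
  unfolding conn_def
proof (induction rule: rtranclp_induct)
  case base
  show ?case by simp
next
  case (step y z)
  then have "{z, y} \<in> E" by (simp add: insert_commute)
  then show ?case using step.IH by (rule converse_rtranclp_into_rtranclp)
qed

text \<open>
  Naming the component turns questions about the equivalence \<open>conn E\<close> into equalities of sets, which
  rewriting decides.
\<close>

definition component :: "'a set set \<Rightarrow> 'a \<Rightarrow> 'a set" where
  "component E u = {v. conn E u v}"

lemma conn_iff_component: "conn E u v \<longleftrightarrow> component E u = component E v"
proof
  assume uv: "conn E u v"
  then have vu: "conn E v u" by (rule conn_sym)
  show "component E u = component E v"
    unfolding component_def using conn_trans[OF uv] conn_trans[OF vu] by blast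
next
  assume "component E u = component E v"
  then show "conn E u v" unfolding component_def by (metis conn_refl mem_Collect_eq)
qed

lemma conn_mono: "conn E u v \<Longrightarrow> E \<subseteq> F \<Longrightarrow> conn F u v"
  unfolding conn_def by (erule mono_rtranclp[rule_format, rotated]) blast

text \<open>
  A walk from inside \<open>P\<close> to outside \<open>P\<close> has a first edge that leaves \<open>P\<close>.
\<close>

lemma conn_leaves:
  assumes "conn E u v" "P u" "\<not> P v"
  obtains c d where "{c, d} \<in> E" "P c" "\<not> P d" "conn E u c"
proof -
  have "P v \<or> (\<exists>c d. {c, d} \<in> E \<and> P c \<and> \<not> P d \<and> conn E u c)"
    using assms(1) unfolding conn_def
    by (induction rule: rtranclp_induct) (use \<open>P u\<close> in auto)
  then show thesis using assms(3) that by blast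
qed

lemma conn_closed:
  assumes "conn E u v" "P u" "\<And>c d. {c, d} \<in> E \<Longrightarrow> P c \<Longrightarrow> P d"
  shows "P v"
  using conn_leaves[OF assms(1), of P] assms(2,3) by blast

lemma conn_image:
  assumes "inj f"
  shows "conn ((`) f ` E) (f u) (f v) \<longleftrightarrow> conn E u v"
proof
  assume "conn E u v"
  then show "conn ((`) f ` E) (f u) (f v)"
    unfolding conn_def
  proof (induction rule: rtranclp_induct)
    case (step y z)
    have "{f y, f z} = f ` {y, z}" by simp
    then have "{f y, f z} \<in> (`) f ` E" using step.hyps(2) by (metis imageI)
    then show ?case using step.IH by (rule rtranclp.rtrancl_into_rtrancl[rotated])
  qed simp
next
  assume "conn ((`) f ` E) (f u) (f v)"
  then have "\<exists>w. f v = f w \<and> conn E u w"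
  proof (rule conn_closed)
    fix c d assume e: "{c, d} \<in> (`) f ` E" and "\<exists>w. c = f w \<and> conn E u w"
    then obtain w where w: "c = f w" "conn E u w" by blast
    from e obtain X where X: "X \<in> E" "{c, d} = f ` X" by blast
    then obtain y where y: "y \<in> X" "d = f y" by (metis imageE insertCI)
    obtain w' where "w' \<in> X" "c = f w'" using X by (metis imageE insertCI)
    then have "w \<in> X" using w \<open>inj f\<close> by (metis injD)
    have "{f w, f y} = f ` X" using w y X by simp
    then have "X = {w, y}" using \<open>inj f\<close> by (metis image_empty image_insert inj_image_eq_iff)
    then show "\<exists>w. d = f w \<and> conn E u w"
      using X(1) w y conn_trans conn_edge by metis
  qed blast
  then show "conn E u v" using \<open>inj f\<close> by (metis injD)
qed

lemma path_in_Cons: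
  "path_in E (u # x # p) \<longleftrightarrow> u \<noteq> x \<and> u \<notin> set p \<and> {u, x} \<in> E \<and> path_in E (x # p)"
  by (auto simp: path_in_def)

lemma path_in_single [simp]: "path_in E [u]"
  by (simp add: path_in_def)

lemma path_in_conn: "path_in E p \<Longrightarrow> conn E (hd p) (last p)"
proof (induction p rule: induct_list012)
  case (3 u x p)
  then show ?case
    by (simp add: path_in_Cons del: last.simps) (metis conn_edge conn_trans last_ConsR list.discI)
qed (auto simp: path_in_def)

lemma path_in_avoid:
  "path_in E p \<Longrightarrow> u \<notin> set p \<Longrightarrow> u \<in> e \<Longrightarrow> path_in (E - {e}) p"
  by (induction p rule: induct_list012) (auto simp: path_in_Cons, simp add: path_in_def)

lemma conn_imp_path:
  assumes "conn E u v"
  shows "\<exists>p. path_between E u v p"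
  using assms unfolding conn_def
proof (induction rule: converse_rtranclp_induct)
  case base
  have "path_between E v v [v]" by (simp add: path_between_def)
  then show ?case by blast
next
  case (step u x)
  then obtain p where p: "path_in E p" "hd p = x" "last p = v" by (auto simp: path_between_def)
  show ?case
  proof (cases "u \<in> set p")
    case True
    then obtain q q' where q: "p = q @ u # q'" by (meson split_list)
    then have "path_in E (u # q')" using p(1)
      by (auto simp: path_in_def successively_append_iff)
    then have "path_between E u v (u # q')" using p(3) q by (simp add: path_between_def)
    then show ?thesis by blast
  next
    case False
    obtain p' where p': "p = x # p'" using p by (metis hd_Cons_tl path_in_def)
    have "path_between E u v (u # p)"
      using False p step.hyps(1) unfolding p' by (auto simp: path_between_def path_in_Cons)
    then show ?thesis by blast
  qed
qed

lemma conn_iff_path: "conn E u v \<longleftrightarrow> (\<exists>p. path_between E u v p)"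
  using conn_imp_path path_in_conn by (metis path_between_def)

text \<open>
  Acyclicity in a form that mentions no cycle: no edge can be bypassed.
\<close>

definition bridges :: "'a set set \<Rightarrow> bool" where
  "bridges E \<longleftrightarrow> (\<forall>x y. {x, y} \<in> E \<longrightarrow> \<not> conn (E - {{x, y}}) x y)"

lemma bridgesD: "bridges E \<Longrightarrow> {x, y} \<in> E \<Longrightarrow> \<not> conn (E - {{x, y}}) x y"
  by (auto simp: bridges_def)

lemma bridges_mono: "bridges E \<Longrightarrow> F \<subseteq> E \<Longrightarrow> bridges F"
  unfolding bridges_def by (meson Diff_mono conn_mono subset_iff subset_refl)

lemma path_in_mono: "path_in E p \<Longrightarrow> E \<subseteq> F \<Longrightarrow> path_in F p"
  by (induction p rule: induct_list012) (auto simp: path_in_Cons path_in_def)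

text \<open>
  The edge that closes a cycle is bypassed by the rest of the cycle. Conversely, a path bypassing
  the edge \<open>{x, y}\<close> has at least three vertices, and the edge closes it to a cycle.
\<close>

lemma acyclic_iff_bridges:
  assumes "\<And>e. e \<in> E \<Longrightarrow> card e = 2"
  shows "\<not> (\<exists>p. cycle_in E p) \<longleftrightarrow> bridges E"
proof
  assume acyc: "\<not> (\<exists>p. cycle_in E p)"
  show "bridges E"
    unfolding bridges_def
  proof (intro allI impI notI)
    fix x y assume e: "{x, y} \<in> E" and "conn (E - {{x, y}}) x y"
    then obtain p where p: "path_in (E - {{x, y}}) p" "hd p = x" "last p = y"
      by (auto simp: conn_iff_path path_between_def)
    have "x \<noteq> y" using assms[OF e] by auto
    then obtain a b q where "p = a # b # q" 
      using p by (cases p rule: remdups_adj.cases) (auto simp: path_in_def)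
    then have "q \<noteq> []" using p by (auto simp: path_in_Cons)
    then have "length p \<ge> 3" using \<open>p = a # b # q\<close> by (cases q) auto
    moreover have "path_in E p" using p(1) by (rule path_in_mono) auto
    moreover have "{last p, hd p} \<in> E" using p e by (simp add: insert_commute)
    ultimately show False using acyc by (auto simp: cycle_in_def)
  qed
next
  assume br: "bridges E"
  show "\<not> (\<exists>p. cycle_in E p)"
  proof
    assume "\<exists>p. cycle_in E p"
    then obtain p where p: "path_in E p" "length p \<ge> 3" "{last p, hd p} \<in> E"
      by (auto simp: cycle_in_def)
    then obtain u x y q where q: "p = u # x # y # q" 
      by (metis Suc_le_length_iff numeral_3_eq_3)
    define e where "e = {last p, hd p}"
    have path: "path_in E (x # y # q)" "u \<notin> set (x # y # q)" "{u, x} \<in> E"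
      using p(1) unfolding q by (auto simp: path_in_Cons)
    have e: "e = {last (y # q), u}" by (simp add: e_def q)
    have "path_in (E - {e}) (x # y # q)" using path by (intro path_in_avoid[of E _ u]) (auto simp: e)
    then have "conn (E - {e}) x (last (y # q))" by (auto dest: path_in_conn)
    moreover have "x \<notin> e" using path by (auto simp: e path_in_def split: if_splits)
    then have "{u, x} \<noteq> e" by auto
    then have "conn (E - {e}) u x" using path by (intro conn_edge) auto
    ultimately have "conn (E - {e}) u (last (y # q))" by (rule conn_trans[rotated])
    moreover have "{u, last (y # q)} = e" "e \<in> E" using p(3) by (auto simp: e q)
    ultimately show False using br bridgesD[of E u "last (y # q)"] by auto
  qed
qed

lemma tree_on_iff:
  "tree_on V E \<longleftrightarrow> V \<noteq> {} \<and> simple_graph V E \<and> (\<forall>u\<in>V. \<forall>v\<in>V. conn E u v) \<and> bridges E"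
  using acyclic_iff_bridges[of E]
  by (auto simp: tree_on_def conn_iff_path simple_graph_def)

definition separators :: "'a set set \<Rightarrow> 'a \<Rightarrow> 'a \<Rightarrow> 'a set set" where
  "separators E u v = {e \<in> E. \<not> conn (E - {e}) u v}"

text \<open>
  The first edge of a path separates the ends of the path, because the rest of the path avoids it;
  every other edge separates the ends of the path iff it separates the ends of the rest.
\<close>

lemma length_path:
  assumes "bridges E" "finite E" "path_between E u v p"
  shows "length p - 1 = card (separators E u v)"
  using assms(3)
proof (induction p arbitrary: u rule: induct_list012)
  case 1
  then show ?case by (simp add: path_between_def path_in_def)
next
  case (2 x)
  then show ?case by (auto simp: path_between_def separators_def)
next
  case (3 a x p)
  have [simp]: "a = u" using 3 by (simp add: path_between_def)
  have p: "path_in E (x # p)" "u \<notin> set (x # p)" "{u, x} \<in> E" "last (x # p) = v"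
    using 3(3) by (auto simp: path_between_def path_in_Cons)
  define e where "e = {u, x}"
  have xv: "conn (E - {e}) x v"
    using path_in_conn[OF path_in_avoid[OF p(1,2), of e]] p(4) by (simp add: e_def)
  have "\<not> conn (E - {e}) u v"
    using bridgesD[OF assms(1) p(3)] xv by (metis conn_sym conn_trans e_def)
  moreover have "conn (E - {f}) u v \<longleftrightarrow> conn (E - {f}) x v" if "f \<noteq> e" for f
  proof -
    have "conn (E - {f}) u x" using p(3) that by (intro conn_edge) (auto simp: e_def)
    then show ?thesis by (metis conn_sym conn_trans)
  qed
  ultimately have "f \<in> separators E u v \<longleftrightarrow> f \<in> insert e (separators E x v)" for f
    using xv p(3) by (cases "f = e") (auto simp: separators_def e_def[symmetric])
  then have "separators E u v = insert e (separators E x v)" by blast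
  moreover have "e \<notin> separators E x v" using xv by (simp add: separators_def)
  moreover have "finite (separators E x v)" using \<open>finite E\<close> by (simp add: separators_def)
  moreover have "length (x # p) - 1 = card (separators E x v)"
    by (rule 3) (use p in \<open>simp add: path_between_def\<close>)
  ultimately show ?case by simp
qed

text \<open>
  If two paths with the same ends first diverged at \<open>u\<close>, towards \<open>x\<close> and \<open>y\<close>, the remaining parts together
  with \<open>{u, y}\<close> would bypass the edge \<open>{u, x}\<close>.
\<close>

lemma path_unique:
  assumes "bridges E" "path_in E p" "path_in E q" "hd p = hd q" "last p = last q"
  shows "p = q"
  using assms(2-)
proof (induction p arbitrary: q rule: induct_list012)
  case 1
  then show ?case by (simp add: path_in_def)
next
  case (2 u)
  then show ?case by (cases q) (auto simp: path_in_def split: if_splits)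
next
  case (3 u x p)
  have p: "path_in E (x # p)" "u \<notin> set (x # p)" "{u, x} \<in> E"
    using 3(3) by (auto simp: path_in_Cons)
  have "last (x # p) \<noteq> u" using p(2) last_in_set[of "x # p"] by auto
  then obtain y q' where q: "q = u # y # q'"
    using 3(4-) by (cases q rule: remdups_adj.cases) (auto simp: path_in_def)
  have q': "path_in E (y # q')" "u \<notin> set (y # q')" "{u, y} \<in> E" "last (y # q') = last (x # p)"
    using 3(4-) unfolding q by (auto simp: path_in_Cons)
  have "x = y"
  proof (rule ccontr)
    assume "x \<noteq> y"
    define e where "e = {u, x}"
    have "conn (E - {e}) x (last (x # p))"
      using path_in_conn[OF path_in_avoid[OF p(1,2), of e]] by (simp add: e_def)
    moreover have "conn (E - {e}) y (last (x # p))"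
      using path_in_conn[OF path_in_avoid[OF q'(1,2), of e]] q'(4) by (simp add: e_def)
    moreover have "conn (E - {e}) u y"
      using q'(3) \<open>x \<noteq> y\<close> by (intro conn_edge) (auto simp: e_def doubleton_eq_iff)
    ultimately have "conn (E - {e}) u x" by (metis conn_sym conn_trans)
    then show False using bridgesD[OF assms(1) p(3)] by (simp add: e_def)
  qed
  moreover have "x # p = y # q'"
    by (rule 3) (use p q' \<open>x = y\<close> in auto)
  ultimately show ?case by (simp add: q)
qed

text \<open>
  For trees this is the graph distance. Counting separating edges makes it additive over the edges,
  so that sums and differences of distances can be evaluated one edge at a time.
\<close>

definition dist_in :: "'a set set \<Rightarrow> 'a \<Rightarrow> 'a \<Rightarrow> nat" where
  "dist_in E u v = card (separators E u v)"

lemma depth_eq_dist_in: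
  assumes "tree_on V E" "finite V" "0 \<in> V" "v \<in> V"
  shows "depth E v = dist_in E 0 v"
proof -
  have tree: "bridges E" "conn E 0 v" and sg: "simple_graph V E"
    using assms by (auto simp: tree_on_iff)
  have "E \<subseteq> Pow V" using sg by (auto simp: simple_graph_def)
  then have "finite E" using \<open>finite V\<close> by (simp add: finite_subset)
  obtain p where p: "path_between E 0 v p" using conn_imp_path[OF tree(2)] by blast
  have "(THE p. path_between E 0 v p) = p"
  proof (rule the_equality)
    fix q assume "path_between E 0 v q"
    then show "q = p" using p path_unique[OF tree(1)] by (auto simp: path_between_def)
  qed (rule p)
  then show ?thesis
    using length_path[OF tree(1) \<open>finite E\<close> p] by (simp add: depth_def dist_in_def)
qed

lemma tree_on_image:
  assumes "inj f" "tree_on V E"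
  shows "tree_on (f ` V) ((`) f ` E)"
proof -
  have "bridges ((`) f ` E)"
    unfolding bridges_def
  proof (intro allI impI)
    fix x y assume e: "{x, y} \<in> (`) f ` E"
    then obtain X where X: "X \<in> E" "{x, y} = f ` X" by blast
    then obtain a b where ab: "a \<in> X" "b \<in> X" "x = f a" "y = f b" by (metis imageE insertCI)
    then have "X = {a, b}" using X \<open>inj f\<close>
      by (metis image_empty image_insert inj_image_eq_iff)
    have "(`) f ` E - {{x, y}} = (`) f ` (E - {X})"
      unfolding X(2) using \<open>inj f\<close> by (auto simp: inj_image_eq_iff)
    then show "\<not> conn ((`) f ` E - {{x, y}}) x y"
      using assms X(1) ab conn_image[OF \<open>inj f\<close>] \<open>X = {a, b}\<close> by (auto simp: tree_on_iff bridges_def)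
  qed
  moreover have "f ` e \<subseteq> f ` V \<and> card (f ` e) = 2" if "e \<in> E" for e
    using assms that by (simp add: tree_on_iff simple_graph_def card_image image_mono inj_on_subset)
  then have "simple_graph (f ` V) ((`) f ` E)"
    by (auto simp: simple_graph_def)
  ultimately show ?thesis
    using assms conn_image[OF \<open>inj f\<close>] by (auto simp: tree_on_iff)
qed

lemma dist_in_image:
  assumes "inj f"
  shows "dist_in ((`) f ` E) (f u) (f v) = dist_in E u v"
proof -
  have "(`) f ` E - {f ` e} = (`) f ` (E - {e})" for e
    using \<open>inj f\<close> by (auto simp: inj_image_eq_iff)
  then have "separators ((`) f ` E) (f u) (f v) = (`) f ` separators E u v"
    using conn_image[OF \<open>inj f\<close>] by (auto simp: separators_def)
  moreover have "inj_on ((`) f) (separators E u v)"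
    using \<open>inj f\<close> by (auto simp: inj_on_def inj_image_eq_iff)
  ultimately show ?thesis by (simp add: dist_in_def card_image)
qed

lemma edge_removal_sides:
  assumes "conn E x w" "{x, y} \<in> E"
  shows "conn (E - {{x, y}}) x w \<or> conn (E - {{x, y}}) y w"
  using assms(1)
proof (rule conn_closed)
  fix c d assume e: "{c, d} \<in> E" and c: "conn (E - {{x, y}}) x c \<or> conn (E - {{x, y}}) y c"
  show "conn (E - {{x, y}}) x d \<or> conn (E - {{x, y}}) y d"
  proof (cases "{c, d} = {x, y}")
    case True
    then show ?thesis by (auto simp: doubleton_eq_iff)
  next
    case False
    then have "conn (E - {{x, y}}) c d" using e by (intro conn_edge) auto
    then show ?thesis using c conn_trans[of _ _ c d] by blast
  qed
qed simp

text \<open>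
  Every vertex stays connected to one of the ends of the deleted edge, so of three vertices two lie in
  the same component.
\<close>

lemma edge_removal_two_classes:
  assumes "tree_on V E" "e \<in> E" "u \<in> V" "v \<in> V" "w \<in> V"
    and "\<not> conn (E - {e}) u v" "\<not> conn (E - {e}) v w"
  shows "conn (E - {e}) u w"
proof -
  have "card e = 2" "e \<subseteq> V" using assms by (auto simp: tree_on_iff simple_graph_def)
  then obtain x y where e: "e = {x, y}" "x \<in> V" by (auto simp: card_2_iff)
  have "conn (E - {e}) x z \<or> conn (E - {e}) y z" if "z \<in> V" for z
    unfolding e(1) by (rule edge_removal_sides) (use assms e that in \<open>auto simp: tree_on_iff\<close>)
  from this[OF assms(3)] this[OF assms(4)] this[OF assms(5)] show ?thesis
    using assms(6,7) by (meson conn_sym conn_trans)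
qed

text \<open>
  Two parts that meet in one vertex \<open>w\<close> can only be changed at \<open>w\<close>, so an excursion of a walk out of
  \<open>V1\<close> returns to where it started and can be left out.
\<close>

lemma conn_restrict:
  assumes "conn E u v" "u \<in> V1" "v \<in> V1"
    and edges: "\<And>f. f \<in> E \<Longrightarrow> f \<subseteq> V1 \<or> f \<subseteq> V2" and "V1 \<inter> V2 \<subseteq> {w}"
  shows "conn {f \<in> E. f \<subseteq> V1} u v"
proof -
  \<comment> \<open>While the walk is outside \<open>V1\<close>, the point to remember is the exit \<open>w\<close>.\<close>
  have "if v \<in> V1 then conn {f \<in> E. f \<subseteq> V1} u v else conn {f \<in> E. f \<subseteq> V1} u w \<and> w \<in> V1"
    using assms(1)
  proof (rule conn_closed)
    fix c d assume e: "{c, d} \<in> E"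
      and c: "if c \<in> V1 then conn {f \<in> E. f \<subseteq> V1} u c else conn {f \<in> E. f \<subseteq> V1} u w \<and> w \<in> V1"
    show "if d \<in> V1 then conn {f \<in> E. f \<subseteq> V1} u d else conn {f \<in> E. f \<subseteq> V1} u w \<and> w \<in> V1"
    proof (cases "c \<in> V1 \<and> d \<in> V1")
      case True
      then have "conn {f \<in> E. f \<subseteq> V1} c d" using e by (intro conn_edge) auto
      then show ?thesis using c True conn_trans[of "{f \<in> E. f \<subseteq> V1}" u c d] by simp
    next
      case False
      then have "c \<in> V2" "d \<in> V2" using edges[OF e] by auto
      then have "c \<in> V1 \<Longrightarrow> c = w" "d \<in> V1 \<Longrightarrow> d = w" using assms(5) by auto
      then show ?thesis using c False by (auto split: if_splits)
    qed
  qed (use \<open>u \<in> V1\<close> in auto)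
  then show ?thesis using \<open>v \<in> V1\<close> by simp
qed

lemma tree_on_subgraph:
  assumes "tree_on V E" "U \<subseteq> V" "U \<noteq> {}"
    and "\<And>u v. u \<in> U \<Longrightarrow> v \<in> U \<Longrightarrow> conn {f \<in> E. f \<subseteq> U} u v"
  shows "tree_on U {f \<in> E. f \<subseteq> U}"
  using assms bridges_mono[of E "{f \<in> E. f \<subseteq> U}"]
  by (auto simp: tree_on_iff simple_graph_def)

text \<open>
  A bypass of an edge of \<open>E1\<close> in the union could be restricted to \<open>V1\<close>, where it would be a bypass in
  \<open>E1\<close> itself.
\<close>

lemma tree_on_join:
  assumes "tree_on V1 E1" "tree_on V2 E2" "V1 \<inter> V2 = {w}"
  shows "tree_on (V1 \<union> V2) (E1 \<union> E2)"
proof -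
  have half: "\<not> conn (E1 \<union> E2 - {{x, y}}) x y"
    if "{x, y} \<in> E1" "tree_on V1 E1" "tree_on V2 E2" "V1 \<inter> V2 = {w}" for x y E1 E2 V1 V2
  proof
    have sub: "\<And>f. f \<in> E1 \<Longrightarrow> f \<subseteq> V1 \<and> card f = 2" "\<And>f. f \<in> E2 \<Longrightarrow> f \<subseteq> V2 \<and> card f = 2"
      using that by (auto simp: tree_on_iff simple_graph_def)
    assume "conn (E1 \<union> E2 - {{x, y}}) x y"
    then have "conn {f \<in> E1 \<union> E2 - {{x, y}}. f \<subseteq> V1} x y"
      by (rule conn_restrict[where ?V2.0 = V2 and w = w]) (use sub that in auto)
    moreover have "f \<in> E1" if "f \<in> E2" "f \<subseteq> V1" for f
    proof -
      have "f \<subseteq> {w}" using sub(2)[OF that(1)] that(2) \<open>V1 \<inter> V2 = {w}\<close> by auto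
      then have "card f \<le> 1" using card_mono[of "{w}" f] by simp
      then show ?thesis using sub(2)[OF that(1)] by simp
    qed
    ultimately have "conn (E1 - {{x, y}}) x y" by (elim conn_mono) auto
    then show False using that by (auto simp: tree_on_iff bridges_def)
  qed
  have "bridges (E1 \<union> E2)"
    unfolding bridges_def
    using half[OF _ assms] half[OF _ assms(2,1)] assms(3) by (auto simp: Int_commute Un_commute)
  moreover have "conn (E1 \<union> E2) w u" if "u \<in> V1 \<union> V2" for u
  proof -
    have "conn E1 w u \<or> conn E2 w u" using that assms by (auto simp: tree_on_iff)
    then show ?thesis by (auto elim: conn_mono)
  qed
  then have "conn (E1 \<union> E2) u v" if "u \<in> V1 \<union> V2" "v \<in> V1 \<union> V2" for u v
    using that conn_trans[OF conn_sym[of _ w u]] by blast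
  ultimately show ?thesis
    using assms by (auto simp: tree_on_iff simple_graph_def)
qed

lemma tree_on_edge: "u \<noteq> v \<Longrightarrow> tree_on {u, v} {{u, v}}"
proof -
  assume "u \<noteq> v"
  have "x = y" if "conn {} x y" for x y :: 'a
    using that unfolding conn_def by (induction rule: rtranclp_induct) auto
  then show ?thesis using \<open>u \<noteq> v\<close>
    by (auto simp: tree_on_iff simple_graph_def bridges_def intro: conn_edge)
       (auto simp: doubleton_eq_iff intro!: conn_edge)
qed

text \<open>
  The new edge is a tree of its own, glued to the first tree at \<open>u\<close> and to the second at \<open>v\<close>.
\<close>

lemma tree_on_bridge_join:
  assumes "tree_on V1 E1" "tree_on V2 E2" "V1 \<inter> V2 = {}" "u \<in> V1" "v \<in> V2"
  shows "tree_on (V1 \<union> V2) (insert {u, v} (E1 \<union> E2))"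
proof -
  have "u \<noteq> v" using assms by auto
  have "tree_on (V1 \<union> {u, v}) (E1 \<union> {{u, v}})"
    by (rule tree_on_join[where w = u]) (use assms tree_on_edge[OF \<open>u \<noteq> v\<close>] in auto)
  then have "tree_on (V1 \<union> {u, v} \<union> V2) (E1 \<union> {{u, v}} \<union> E2)"
    by (rule tree_on_join[where w = v]) (use assms in auto)
  moreover have "V1 \<union> {u, v} \<union> V2 = V1 \<union> V2" using assms by auto
  ultimately show ?thesis by (simp add: insert_commute)
qed

section \<open>Crossing chords of a circle\<close>

text \<open>
  The combinatorial counterpart of \<open>noncrossing\<close>: no two edges have interleaved ends.
\<close>

definition uncrossed :: "nat set set \<Rightarrow> bool" where
  "uncrossed E \<longleftrightarrow>
     (\<forall>a b c d. {a, b} \<in> E \<longrightarrow> {c, d} \<in> E \<longrightarrow> \<not> (a < c \<and> c < b \<and> b < d))"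

text \<open>
  Twice the signed area of the triangle \<open>A B P\<close>; it is positive iff \<open>P\<close> lies to the left of the line from
  \<open>A\<close> to \<open>B\<close>. As a function of \<open>P\<close> it is affine, which is what makes it useful for segments.
\<close>

definition orient :: "complex \<Rightarrow> complex \<Rightarrow> complex \<Rightarrow> real" where
  "orient A B P = (Re B - Re A) * (Im P - Im A) - (Im B - Im A) * (Re P - Re A)"

lemma orient_cycle: "orient B P A = orient A B P"
  by (simp add: orient_def algebra_simps)

lemma orient_swap: "orient B A P = - orient A B P"
  by (simp add: orient_def algebra_simps)

lemma orient_degenerate [simp]: "orient A A P = 0" "orient A B A = 0" "orient A B B = 0"
  by (simp_all add: orient_def algebra_simps)

lemma orient_affine:
  "orient A B ((1 - u) *\<^sub>R P + u *\<^sub>R Q) = (1 - u) * orient A B P + u * orient A B Q"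
  by (simp add: orient_def algebra_simps)

text \<open>
  In this product form the sign can be read off: for \<open>\<alpha> < \<beta> < \<gamma> < \<alpha> + 2\<pi>\<close> all three half angles lie strictly
  between \<open>0\<close> and \<open>\<pi>\<close>.
\<close>

lemma orient_cis:
  "orient (cis \<alpha>) (cis \<beta>) (cis \<gamma>) =
     4 * sin ((\<beta> - \<alpha>) / 2) * sin ((\<gamma> - \<beta>) / 2) * sin ((\<gamma> - \<alpha>) / 2)"
proof -
  define x y where "x = (\<beta> - \<alpha>) / 2" and "y = (\<gamma> - \<beta>) / 2"
  have e: "\<beta> = \<alpha> + 2 * x" "\<gamma> = \<alpha> + 2 * x + 2 * y" "(\<gamma> - \<alpha>) / 2 = x + y"
    by (simp_all add: x_def y_def field_simps)
  have "orient (cis \<alpha>) (cis \<beta>) (cis \<gamma>) = sin (\<gamma> - \<beta>) + sin (\<beta> - \<alpha>) - sin (\<gamma> - \<alpha>)"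
    by (simp add: orient_def sin_diff algebra_simps)
  also have "\<dots> = sin (2 * y) + sin (2 * x) - sin (2 * (x + y))"
    by (simp add: e(1,2) algebra_simps)
  also have "\<dots> = 2 * sin y * cos y + 2 * sin x * cos x
      - 2 * (sin x * cos y + cos x * sin y) * (cos x * cos y - sin x * sin y)"
    unfolding sin_double by (simp add: sin_add cos_add)
  also have "\<dots> = 2 * sin y * cos y * (1 - (cos x)\<^sup>2) + 2 * sin x * cos x * (1 - (cos y)\<^sup>2)
      + 2 * (sin x)\<^sup>2 * sin y * cos y + 2 * (sin y)\<^sup>2 * sin x * cos x"
    by (simp add: algebra_simps power2_eq_square)
  also have "\<dots> = 4 * sin x * sin y * (sin x * cos y + cos x * sin y)"
    unfolding sin_squared_eq[symmetric] by (simp add: algebra_simps power2_eq_square)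
  finally show ?thesis
    by (simp add: e(3) sin_add x_def[symmetric] y_def[symmetric])
qed

lemma orient_node_point_pos:
  assumes "a < b" "b < c" "c \<le> n"
  shows "orient (node_point n a) (node_point n b) (node_point n c) > 0"
proof -
  have half: "sin ((2 * pi * real j / real (n + 1) - 2 * pi * real i / real (n + 1)) / 2) > 0"
    if "i < j" "j \<le> n" for i j
  proof -
    define q where "q = (real j - real i) / real (n + 1)"
    have eq: "(2 * pi * real j / real (n + 1) - 2 * pi * real i / real (n + 1)) / 2 = pi * q"
      unfolding q_def using of_nat_0_less_iff[of "n + 1"] by (simp add: field_simps del: of_nat_add of_nat_Suc)
    have "0 < q" "q < 1" using that by (auto simp: q_def)
    then show ?thesis unfolding eq by (intro sin_gt_zero) auto
  qed
  show ?thesis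
    unfolding node_point_def orient_cis
    using assms by (intro mult_pos_pos half) auto
qed

lemma orient_open_segment_0:
  assumes "P \<in> open_segment A B"
  shows "orient A B P = 0"
  using assms by (auto simp: in_segment orient_affine)

lemma orient_open_segment_pos:
  assumes "P \<in> open_segment C D" "orient A B C \<ge> 0" "orient A B D \<ge> 0"
    and "orient A B C > 0 \<or> orient A B D > 0"
  shows "orient A B P > 0"
proof -
  obtain u where u: "0 < u" "u < 1" "P = (1 - u) *\<^sub>R C + u *\<^sub>R D"
    using assms(1) by (auto simp: in_segment)
  have "(1 - u) * orient A B C \<ge> 0" "u * orient A B D \<ge> 0" using u assms by simp_all
  moreover have "(1 - u) * orient A B C > 0 \<or> u * orient A B D > 0"
    using u assms(4) by auto
  ultimately show ?thesis unfolding u(3) orient_affine by linarith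
qed

lemma open_segments_disjoint:
  assumes "orient A B C \<ge> 0" "orient A B D \<ge> 0" "orient A B C > 0 \<or> orient A B D > 0"
  shows "open_segment A B \<inter> open_segment C D = {}"
  using orient_open_segment_0[of _ A B] orient_open_segment_pos[OF _ assms] by fastforce

text \<open>
  Each segment meets the line through the other; the two meeting points agree, as a computation
  with the explicit parameters \<open>s\<close> and \<open>t\<close> shows.
\<close>

lemma open_segments_cross:
  assumes "orient A B C > 0" "orient A B D < 0" "orient C D A < 0" "orient C D B > 0"
  shows "open_segment A B \<inter> open_segment C D \<noteq> {}"
proof -
  define s t where "s = orient A B C / (orient A B C - orient A B D)"
    and "t = orient C D A / (orient C D A - orient C D B)"
  have st: "0 < s" "s < 1" "0 < t" "t < 1" using assms by (auto simp: s_def t_def field_simps)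
  have "A \<noteq> B" "C \<noteq> D" using assms by auto
  define w where "w = orient A B C - orient A B D"
  have w: "w \<noteq> 0" using assms by (simp add: w_def)
  have w': "orient C D A - orient C D B = - w"
    by (simp add: w_def orient_def algebra_simps)
  have "s * w = orient A B C" "t * w = - orient C D A"
    using w by (simp_all add: s_def t_def w' w_def[symmetric])
  then have "w * Re ((1 - s) *\<^sub>R C + s *\<^sub>R D) = w * Re ((1 - t) *\<^sub>R A + t *\<^sub>R B)"
            "w * Im ((1 - s) *\<^sub>R C + s *\<^sub>R D) = w * Im ((1 - t) *\<^sub>R A + t *\<^sub>R B)"
    by (simp_all add: w_def orient_def) algebra+
  then have "(1 - s) *\<^sub>R C + s *\<^sub>R D = (1 - t) *\<^sub>R A + t *\<^sub>R B"
    using w by (auto simp: complex_eq_iff)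
  moreover have "(1 - s) *\<^sub>R C + s *\<^sub>R D \<in> open_segment C D"
    using st \<open>C \<noteq> D\<close> by (auto simp: in_segment)
  moreover have "(1 - t) *\<^sub>R A + t *\<^sub>R B \<in> open_segment A B"
    using st \<open>A \<noteq> B\<close> by (auto simp: in_segment)
  ultimately show ?thesis by auto
qed

lemma chords_cross:
  assumes "a < c" "c < b" "b < d" "d \<le> n"
  shows "open_segment (node_point n a) (node_point n b) \<inter>
         open_segment (node_point n c) (node_point n d) \<noteq> {}"
proof -
  let ?P = "node_point n"
  have perm: "orient A B C = - orient A C B" "orient D C A = - orient A C D"
    "orient D C B = orient C B D" for A B C D
    by (simp_all add: orient_def algebra_simps)
  have "orient (?P a) (?P b) (?P d) > 0"
    by (rule orient_node_point_pos) (use assms in auto)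
  moreover have "orient (?P a) (?P b) (?P c) < 0"
    unfolding perm(1)[of "?P a" "?P b" "?P c"] using orient_node_point_pos[of a c b n] assms by simp
  moreover have "orient (?P d) (?P c) (?P a) < 0"
    unfolding perm(2)[of "?P d" "?P c" "?P a"] using orient_node_point_pos[of a c d n] assms by simp
  moreover have "orient (?P d) (?P c) (?P b) > 0"
    unfolding perm(3)[of "?P d" "?P c" "?P b"] using orient_node_point_pos[of c b d n] assms by simp
  ultimately have "open_segment (?P a) (?P b) \<inter> open_segment (?P d) (?P c) \<noteq> {}"
    by (rule open_segments_cross)
  then show ?thesis by (simp add: open_segment_commute)
qed

text \<open>
  If the ends of one chord are not separated by the other chord, they lie on one closed side of it,
  and not both on its line.
\<close>

lemma chords_disjoint:
  assumes "a < b" "c < d" "b \<le> n" "d \<le> n" "(a, b) \<noteq> (c, d)"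
    and "\<not> (a < c \<and> c < b \<and> b < d)" "\<not> (c < a \<and> a < d \<and> d < b)"
  shows "open_segment (node_point n a) (node_point n b) \<inter>
         open_segment (node_point n c) (node_point n d) = {}"
proof -
  let ?P = "node_point n"
  have in_out: "orient (?P x) (?P y) (?P z) > 0 \<longleftrightarrow> z < x \<or> y < z"
               "orient (?P y) (?P x) (?P z) > 0 \<longleftrightarrow> x < z \<and> z < y"
    if "x < y" "y \<le> n" "z \<le> n" for x y z
  proof -
    have swap: "orient (?P y) (?P x) (?P z) = - orient (?P x) (?P y) (?P z)"
      by (rule orient_swap)
    have left: "orient (?P x) (?P y) (?P z) > 0" if "z < x"
      using orient_node_point_pos[of z x y n] that \<open>x < y\<close> \<open>y \<le> n\<close>
        orient_cycle[of "?P x" "?P y" "?P z"] orient_cycle[of "?P y" "?P z" "?P x"] by simp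
    have mid: "orient (?P y) (?P x) (?P z) > 0" if "x < z" "z < y"
      using orient_node_point_pos[of x z y n] that \<open>y \<le> n\<close>
        orient_cycle[of "?P x" "?P z" "?P y"] orient_cycle[of "?P y" "?P x" "?P z"] by simp
    have right: "orient (?P x) (?P y) (?P z) > 0" if "y < z"
      using orient_node_point_pos[of x y z n] that \<open>x < y\<close> \<open>z \<le> n\<close> by simp
    consider "z < x" | "z = x" | "x < z" "z < y" | "z = y" | "y < z" by linarith
    then have "(orient (?P x) (?P y) (?P z) > 0 \<longleftrightarrow> z < x \<or> y < z) \<and>
               (orient (?P y) (?P x) (?P z) > 0 \<longleftrightarrow> x < z \<and> z < y)"
    proof cases
      case 1
      then show ?thesis using left swap by simp
    next
      case 3
      then show ?thesis using mid swap by simp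
    next
      case 5
      then show ?thesis using right swap by simp
    qed (use \<open>x < y\<close> in auto)
    then show "orient (?P x) (?P y) (?P z) > 0 \<longleftrightarrow> z < x \<or> y < z"
              "orient (?P y) (?P x) (?P z) > 0 \<longleftrightarrow> x < z \<and> z < y" by auto
  qed
  have sgn: "orient (?P x) (?P y) (?P z) \<ge> 0 \<longleftrightarrow> \<not> orient (?P y) (?P x) (?P z) > 0" for x y z
    using orient_swap[of "?P x" "?P y" "?P z"] by auto
  \<comment> \<open>The chord \<open>c d\<close> lies on one of the two arcs cut off by \<open>a\<close> and \<open>b\<close>; the orientation is chosen accordingly.\<close>
  have "(a \<le> c \<and> d \<le> b) \<or> \<not> (a < c \<and> c < b) \<and> \<not> (a < d \<and> d < b)"
    using assms by linarith
  then show ?thesis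
  proof
    assume inside: "a \<le> c \<and> d \<le> b"
    then have "open_segment (?P b) (?P a) \<inter> open_segment (?P c) (?P d) = {}"
      using assms by (intro open_segments_disjoint) (auto simp: sgn in_out)
    then show ?thesis by (simp add: open_segment_commute)
  next
    assume outside: "\<not> (a < c \<and> c < b) \<and> \<not> (a < d \<and> d < b)"
    then show ?thesis
      using assms by (intro open_segments_disjoint) (auto simp: sgn in_out)
  qed
qed

lemma noncrossing_iff_uncrossed:
  assumes "simple_graph {0..n} E"
  shows "noncrossing n E \<longleftrightarrow> uncrossed E"
proof
  assume nc: "noncrossing n E"
  show "uncrossed E"
    unfolding uncrossed_def
  proof (intro allI impI notI)
    fix a b c d assume e: "{a, b} \<in> E" "{c, d} \<in> E" and lt: "a < c \<and> c < b \<and> b < d"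
    have "{c, d} \<subseteq> {0..n}" using assms e(2) by (auto simp: simple_graph_def)
    moreover have "{a, b} \<noteq> {c, d}" using lt by (auto simp: doubleton_eq_iff)
    ultimately show False
      using nc e chords_cross[of a c b d n] lt unfolding noncrossing_def by auto
  qed
next
  assume uc: "uncrossed E"
  have ordered: "open_segment (node_point n a) (node_point n b) \<inter>
        open_segment (node_point n c) (node_point n d) = {}"
    if "{a, b} \<in> E" "{c, d} \<in> E" "{a, b} \<noteq> {c, d}" "a < b" "c < d" for a b c d
  proof (rule chords_disjoint)
    show "b \<le> n" "d \<le> n" using assms that(1,2) by (auto simp: simple_graph_def)
    show "(a, b) \<noteq> (c, d)" using that by auto
    show "\<not> (a < c \<and> c < b \<and> b < d)" "\<not> (c < a \<and> a < d \<and> d < b)"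
      using uc that unfolding uncrossed_def by blast+
  qed (use that in auto)
  show "noncrossing n E"
    unfolding noncrossing_def
  proof (intro allI impI)
    fix a b c d assume *: "{a, b} \<in> E \<and> {c, d} \<in> E \<and> {a, b} \<noteq> {c, d}"
    then have "card {a, b} = 2" "card {c, d} = 2" using assms by (auto simp: simple_graph_def)
    then have "a \<noteq> b" "c \<noteq> d" by auto
    then have "a < b \<or> b < a" "c < d \<or> d < c" by auto
    then show "open_segment (node_point n a) (node_point n b) \<inter>
        open_segment (node_point n c) (node_point n d) = {}"
      using * ordered[of a b c d] ordered[of b a c d] ordered[of a b d c] ordered[of b a d c]
      by (auto simp: insert_commute open_segment_commute)
  qed
qed

section \<open>Cutting and joining noncrossing trees\<close>

text \<open>
  Intervals \<open>{a..b}\<close> stand for arcs of the circle: the parts into which a noncrossing tree is cut below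
  are noncrossing trees on such arcs.
\<close>

definition nctrees :: "nat \<Rightarrow> nat \<Rightarrow> nat set set set" where
  "nctrees a b = {E. tree_on {a..b} E \<and> uncrossed E}"

text \<open>
  No edge passes over \<open>w\<close>. For a tree on an arc, these are the vertices that can be joined to a point
  outside the arc without a crossing.
\<close>

definition exposed :: "nat set set \<Rightarrow> nat \<Rightarrow> bool" where
  "exposed E w \<longleftrightarrow> (\<forall>x y. {x, y} \<in> E \<longrightarrow> \<not> (x < w \<and> w < y))"

definition cut_at :: "nat \<Rightarrow> nat set set \<Rightarrow> bool" where
  "cut_at m F \<longleftrightarrow> (\<forall>f\<in>F. f \<subseteq> {..m} \<or> f \<subseteq> {m<..})"

lemma noncrossing_trees_eq: "noncrossing_trees n = nctrees 0 n"
  using noncrossing_iff_uncrossed[of n]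
  by (auto simp: noncrossing_trees_def nctrees_def tree_on_iff)

lemma nctrees_edge:
  assumes "E \<in> nctrees a b" "f \<in> E"
  obtains x y where "f = {x, y}" "a \<le> x" "x < y" "y \<le> b"
proof -
  have f: "f \<subseteq> {a..b}" "card f = 2"
    using assms by (auto simp: nctrees_def tree_on_iff simple_graph_def)
  then obtain x y where "f = {x, y}" "x \<noteq> y" by (auto simp: card_2_iff)
  then show thesis
    using f that[of x y] that[of y x] by (cases "x < y") (auto simp: insert_commute)
qed

lemma nctrees_edge_subset: "E \<in> nctrees a b \<Longrightarrow> f \<in> E \<Longrightarrow> f \<subseteq> {a..b}"
  by (auto simp: nctrees_def tree_on_iff simple_graph_def)

lemma nctrees_conn: "E \<in> nctrees a b \<Longrightarrow> u \<in> {a..b} \<Longrightarrow> v \<in> {a..b} \<Longrightarrow> conn E u v"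
  by (auto simp: nctrees_def tree_on_iff)

lemma finite_nctrees [simp]: "finite (nctrees a b)"
proof (rule finite_subset)
  show "nctrees a b \<subseteq> Pow (Pow {a..b})"
    by (auto dest!: nctrees_edge_subset)
qed simp

lemma finite_nctree: "E \<in> nctrees a b \<Longrightarrow> finite E"
  by (rule finite_subset[of _ "Pow {a..b}"]) (auto dest!: nctrees_edge_subset)

lemma uncrossed_mono: "uncrossed E \<Longrightarrow> F \<subseteq> E \<Longrightarrow> uncrossed F"
  unfolding uncrossed_def by blast

lemma nctrees_single: "nctrees a a = {{}}"
proof
  have "f \<notin> E" if "E \<in> nctrees a a" for E f
  proof
    assume "f \<in> E"
    with that obtain x y where "a \<le> x" "x < y" "y \<le> a" by (rule nctrees_edge)
    then show False by simp
  qed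
  then show "nctrees a a \<subseteq> {{}}" by auto
  show "{{}} \<subseteq> nctrees a a"
    by (simp add: nctrees_def tree_on_iff simple_graph_def bridges_def uncrossed_def)
qed

lemma exposed_iff_halves:
  assumes "E \<in> nctrees a b"
  shows "exposed E w \<longleftrightarrow> (\<forall>f\<in>E. f \<subseteq> {a..w} \<or> f \<subseteq> {w..b})"
proof
  assume ex: "exposed E w"
  show "\<forall>f\<in>E. f \<subseteq> {a..w} \<or> f \<subseteq> {w..b}"
  proof
    fix f assume f: "f \<in> E"
    obtain x y where "f = {x, y}" "a \<le> x" "x < y" "y \<le> b" using assms f by (rule nctrees_edge)
    then show "f \<subseteq> {a..w} \<or> f \<subseteq> {w..b}" using ex f unfolding exposed_def by fastforce
  qed
next
  assume *: "\<forall>f\<in>E. f \<subseteq> {a..w} \<or> f \<subseteq> {w..b}"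
  show "exposed E w"
    unfolding exposed_def
  proof (intro allI impI notI)
    fix x y assume "{x, y} \<in> E" "x < w \<and> w < y"
    with * show False by fastforce
  qed
qed

text \<open>
  Edges from different sides of \<open>w\<close> can share the end \<open>w\<close> at most, hence cannot interleave.
\<close>

lemma uncrossed_Un:
  assumes "uncrossed E1" "uncrossed E2"
    and "\<And>f. f \<in> E1 \<Longrightarrow> f \<subseteq> {..w}" "\<And>f. f \<in> E2 \<Longrightarrow> f \<subseteq> {w..}"
  shows "uncrossed (E1 \<union> E2)"
  unfolding uncrossed_def
proof (intro allI impI notI)
  fix a b c d
  assume e: "{a, b} \<in> E1 \<union> E2" "{c, d} \<in> E1 \<union> E2" and lt: "a < c \<and> c < b \<and> b < d"
  have "\<not> ({a, b} \<in> E1 \<and> {c, d} \<in> E2)" "\<not> ({a, b} \<in> E2 \<and> {c, d} \<in> E1)"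
    using assms(3,4) lt by fastforce+
  then show False using e lt assms(1,2) unfolding uncrossed_def by blast
qed

lemma uncrossed_insert:
  assumes "uncrossed E" "exposed {f \<in> E. f \<subseteq> {..m}} u" "exposed {f \<in> E. f \<subseteq> {m<..}} v"
    and "u \<le> m" "m < v" "cut_at m E"
  shows "uncrossed (insert {u, v} E)"
  unfolding uncrossed_def
proof (intro allI impI notI)
  fix a b c d
  assume e: "{a, b} \<in> insert {u, v} E" "{c, d} \<in> insert {u, v} E"
    and lt: "a < c \<and> c < b \<and> b < d"
  have side: "{x, y} \<subseteq> {..m} \<or> {x, y} \<subseteq> {m<..}" if "{x, y} \<in> E" for x y
    by (rule assms(6)[unfolded cut_at_def, rule_format, OF that])
  have clear: "\<not> (x < u \<and> u < y \<and> y < v)" "\<not> (u < x \<and> x < v \<and> v < y)" if "{x, y} \<in> E" for x y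
    using side[OF that] that assms(2-5) unfolding exposed_def by auto
  consider "{a, b} \<in> E" "{c, d} \<in> E" | "{a, b} = {u, v}" "{c, d} \<in> E"
    | "{a, b} \<in> E" "{c, d} = {u, v}" | "{a, b} = {u, v}" "{c, d} = {u, v}" using e by blast
  then show False
  proof cases
    case 1
    then show ?thesis using lt assms(1) unfolding uncrossed_def by blast
  next
    case 2
    then have "a = u" "b = v" using lt assms(4,5) by (auto simp: doubleton_eq_iff)
    then show ?thesis using lt clear[OF 2(2)] by auto
  next
    case 3
    then have "c = u" "d = v" using lt assms(4,5) by (auto simp: doubleton_eq_iff)
    then show ?thesis using lt clear[OF 3(1)] by auto
  next
    case 4
    then show ?thesis using lt by (auto simp: doubleton_eq_iff)
  qed
qed

lemma Collect_Un_cover: "\<forall>x\<in>A. P x \<or> Q x \<Longrightarrow> {x \<in> A. P x} \<union> {x \<in> A. Q x} = A"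
  by blast

text \<open>
  A noncrossing tree with an exposed vertex \<open>w\<close> is the same as two noncrossing trees glued at \<open>w\<close>: no edge
  passes over \<open>w\<close>, so each edge belongs to exactly one of the two arcs.
\<close>

lemma bij_vertex_join:
  assumes "a \<le> w" "w \<le> b"
  shows "bij_betw (\<lambda>(E1, E2). E1 \<union> E2) (nctrees a w \<times> nctrees w b)
           {E \<in> nctrees a b. exposed E w}"
proof (rule bij_betw_byWitness[where f' = "\<lambda>E. ({f \<in> E. f \<subseteq> {a..w}}, {f \<in> E. f \<subseteq> {w..b}})"])
  have only_half: "{f \<in> E1 \<union> E2. f \<subseteq> {a..w}} = E1" "{f \<in> E1 \<union> E2. f \<subseteq> {w..b}} = E2"
    if "E1 \<in> nctrees a w" "E2 \<in> nctrees w b" for E1 E2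
  proof -
    have "\<not> f \<subseteq> {a..w}" if "f \<in> E2" for f
      using \<open>E2 \<in> nctrees w b\<close> that by (elim nctrees_edge) auto
    moreover have "\<not> f \<subseteq> {w..b}" if "f \<in> E1" for f
      using \<open>E1 \<in> nctrees a w\<close> that by (elim nctrees_edge) auto
    ultimately show "{f \<in> E1 \<union> E2. f \<subseteq> {a..w}} = E1" "{f \<in> E1 \<union> E2. f \<subseteq> {w..b}} = E2"
      using nctrees_edge_subset[OF that(1)] nctrees_edge_subset[OF that(2)] by blast+
  qed
  then show "\<forall>p\<in>nctrees a w \<times> nctrees w b.
      (\<lambda>E. ({f \<in> E. f \<subseteq> {a..w}}, {f \<in> E. f \<subseteq> {w..b}})) ((\<lambda>(E1, E2). E1 \<union> E2) p) = p"
    by auto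
  show "\<forall>E\<in>{E \<in> nctrees a b. exposed E w}.
      (\<lambda>(E1, E2). E1 \<union> E2) ({f \<in> E. f \<subseteq> {a..w}}, {f \<in> E. f \<subseteq> {w..b}}) = E"
    unfolding prod.case
    by (intro ballI Collect_Un_cover) (metis (no_types, lifting) exposed_iff_halves mem_Collect_eq)
  show "(\<lambda>(E1, E2). E1 \<union> E2) ` (nctrees a w \<times> nctrees w b) \<subseteq> {E \<in> nctrees a b. exposed E w}"
  proof clarify
    fix E1 E2 assume E: "E1 \<in> nctrees a w" "E2 \<in> nctrees w b"
    have sub: "\<And>f. f \<in> E1 \<Longrightarrow> f \<subseteq> {a..w}" "\<And>f. f \<in> E2 \<Longrightarrow> f \<subseteq> {w..b}"
      using E nctrees_edge_subset by blast+
    have "tree_on ({a..w} \<union> {w..b}) (E1 \<union> E2)"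
      by (rule tree_on_join[where w = w]) (use E assms in \<open>auto simp: nctrees_def\<close>)
    moreover have "{a..w} \<union> {w..b} = {a..b}" using assms by auto
    moreover have "uncrossed (E1 \<union> E2)"
    proof (rule uncrossed_Un[where w = w])
      show "uncrossed E1" "uncrossed E2" using E by (auto simp: nctrees_def)
    qed (use sub in fastforce)+
    ultimately have "E1 \<union> E2 \<in> nctrees a b" by (simp add: nctrees_def)
    moreover from this have "exposed (E1 \<union> E2) w"
      using sub by (simp only: exposed_iff_halves) blast
    ultimately show "E1 \<union> E2 \<in> nctrees a b \<and> exposed (E1 \<union> E2) w" ..
  qed
  show "(\<lambda>E. ({f \<in> E. f \<subseteq> {a..w}}, {f \<in> E. f \<subseteq> {w..b}})) ` {E \<in> nctrees a b. exposed E w}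
      \<subseteq> nctrees a w \<times> nctrees w b"
  proof clarify
    fix E assume E: "E \<in> nctrees a b" "exposed E w"
    then have half: "f \<subseteq> {a..w} \<or> f \<subseteq> {w..b}" if "f \<in> E" for f
      using exposed_iff_halves that by blast
    have tree: "tree_on {a..b} E" and uc: "uncrossed E" using E by (auto simp: nctrees_def)
    have "tree_on {a..w} {f \<in> E. f \<subseteq> {a..w}}"
    proof (rule tree_on_subgraph[OF tree])
      fix u v assume "u \<in> {a..w}" "v \<in> {a..w}"
      then show "conn {f \<in> E. f \<subseteq> {a..w}} u v"
        using assms half by (intro conn_restrict[where ?V2.0 = "{w..b}" and w = w] nctrees_conn[OF E(1)]) auto
    qed (use assms in auto)
    moreover have "tree_on {w..b} {f \<in> E. f \<subseteq> {w..b}}"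
    proof (rule tree_on_subgraph[OF tree])
      fix u v assume "u \<in> {w..b}" "v \<in> {w..b}"
      then show "conn {f \<in> E. f \<subseteq> {w..b}} u v"
        using assms half by (intro conn_restrict[where ?V2.0 = "{a..w}" and w = w] nctrees_conn[OF E(1)]) auto
    qed (use assms in auto)
    moreover have "uncrossed {f \<in> E. f \<subseteq> {a..w}}" "uncrossed {f \<in> E. f \<subseteq> {w..b}}"
      by (rule uncrossed_mono[OF uc]; blast)+
    ultimately show "{f \<in> E. f \<subseteq> {a..w}} \<in> nctrees a w \<and> {f \<in> E. f \<subseteq> {w..b}} \<in> nctrees w b"
      by (simp add: nctrees_def)
  qed
qed

lemma conn_cut:
  assumes "cut_at m F" "conn F u v"
  shows "u \<le> m \<longleftrightarrow> v \<le> m"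
proof -
  have "v \<le> m" if "u \<le> m" "conn F u v" for u v
    using that(2,1) by (rule conn_closed) (use assms(1) in \<open>fastforce simp: cut_at_def\<close>)
  from this[of u v] this[of v u] show ?thesis using assms(2) conn_sym[OF assms(2)] by blast
qed

lemma cut_edge:
  assumes "E \<in> nctrees a b" "a \<le> m" "m < b" "cut_at m (E - {e})"
  obtains u v where "e = {u, v}" "u \<in> {a..m}" "v \<in> {m<..b}" "{u, v} \<in> E"
proof -
  have "conn E a b" using assms by (intro nctrees_conn[OF assms(1)]) auto
  then obtain c d where cd: "{c, d} \<in> E" "c \<le> m" "\<not> d \<le> m"
    by (rule conn_leaves[where P = "\<lambda>x. x \<le> m"]) (use assms(2,3) in auto)
  have "e = {c, d}"
  proof (rule ccontr)
    assume "e \<noteq> {c, d}"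
    then have "{c, d} \<subseteq> {..m} \<or> {c, d} \<subseteq> {m<..}"
      using cd(1) by (intro assms(4)[unfolded cut_at_def, rule_format]) simp
    then show False using cd by auto
  qed
  moreover have "{c, d} \<subseteq> {a..b}" using nctrees_edge_subset[OF assms(1) cd(1)] .
  ultimately show thesis using that[of c d] cd by auto
qed

text \<open>
  If only \<open>e\<close> connects the two arcs, then after deleting \<open>e\<close> the components are the two arcs: a vertex is
  still connected to one of the ends of \<open>e\<close>, and no edge is left that could change sides.
\<close>

lemma cut_conn_iff:
  assumes "E \<in> nctrees a b" "a \<le> m" "m < b" "cut_at m (E - {e})" "i \<in> {a..b}" "j \<in> {a..b}"
  shows "conn (E - {e}) i j \<longleftrightarrow> (i \<le> m \<longleftrightarrow> j \<le> m)"
proof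
  show "conn (E - {e}) i j \<Longrightarrow> (i \<le> m \<longleftrightarrow> j \<le> m)"
    using assms(4) by (rule conn_cut)
next
  assume same: "i \<le> m \<longleftrightarrow> j \<le> m"
  obtain u v where e: "e = {u, v}" "u \<in> {a..m}" "v \<in> {m<..b}" "{u, v} \<in> E"
    using assms(1-4) by (rule cut_edge)
  have side: "conn (E - {e}) (if k \<le> m then u else v) k" if "k \<in> {a..b}" for k
  proof -
    have "conn E u k" using e that assms by (intro nctrees_conn[OF assms(1)]) auto
    then have "conn (E - {e}) u k \<or> conn (E - {e}) v k"
      unfolding e(1) using e(4) by (rule edge_removal_sides)
    moreover have "u \<le> m" "\<not> v \<le> m" using e by auto
    ultimately show ?thesis using conn_cut[OF assms(4)] by auto
  qed
  show "conn (E - {e}) i j"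
    using side[OF assms(5)] side[OF assms(6)] unfolding same by (rule conn_trans[OF conn_sym])
qed

text \<open>
  An edge that is the only one between two arcs can be removed, leaving two noncrossing trees in
  which its ends are exposed; conversely, two exposed vertices can always be joined.
\<close>

lemma bij_bridge_join:
  assumes "u \<in> {a..m}" "v \<in> {m<..b}"
  shows "bij_betw (\<lambda>(E1, E2). insert {u, v} (E1 \<union> E2))
           ({E \<in> nctrees a m. exposed E u} \<times> {E \<in> nctrees (Suc m) b. exposed E v})
           {E \<in> nctrees a b. {u, v} \<in> E \<and> cut_at m (E - {{u, v}})}"
    (is "bij_betw ?join (?A \<times> ?B) ?C")
proof (rule bij_betw_byWitness[where f' = "\<lambda>E. ({f \<in> E. f \<subseteq> {a..m}}, {f \<in> E. f \<subseteq> {Suc m..b}})"])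
  have am: "a \<le> m" "m < b" using assms by auto
  have uv: "\<not> {u, v} \<subseteq> {a..m}" "\<not> {u, v} \<subseteq> {Suc m..b}" using assms by auto
  have halves: "{f \<in> ?join (E1, E2). f \<subseteq> {a..m}} = E1" "{f \<in> ?join (E1, E2). f \<subseteq> {Suc m..b}} = E2"
    if "E1 \<in> nctrees a m" "E2 \<in> nctrees (Suc m) b" for E1 E2
  proof -
    have "\<not> f \<subseteq> {a..m}" if "f \<in> E2" for f
      using \<open>E2 \<in> nctrees (Suc m) b\<close> that by (elim nctrees_edge) auto
    moreover have "\<not> f \<subseteq> {Suc m..b}" if "f \<in> E1" for f
      using \<open>E1 \<in> nctrees a m\<close> that by (elim nctrees_edge) auto
    ultimately show "{f \<in> ?join (E1, E2). f \<subseteq> {a..m}} = E1" "{f \<in> ?join (E1, E2). f \<subseteq> {Suc m..b}} = E2"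
      using nctrees_edge_subset[OF that(1)] nctrees_edge_subset[OF that(2)] uv by blast+
  qed
  then show "\<forall>p\<in>?A \<times> ?B. ({f \<in> ?join p. f \<subseteq> {a..m}}, {f \<in> ?join p. f \<subseteq> {Suc m..b}}) = p"
    by auto
  have split: "f \<subseteq> {a..m} \<or> f \<subseteq> {Suc m..b}" if "E \<in> ?C" "f \<in> E - {{u, v}}" for E f
  proof -
    have "f \<subseteq> {a..b}" "f \<subseteq> {..m} \<or> f \<subseteq> {m<..}"
      using that nctrees_edge_subset[of E a b f] by (auto simp: cut_at_def)
    then show ?thesis by fastforce
  qed
  show "\<forall>E\<in>?C. ?join ({f \<in> E. f \<subseteq> {a..m}}, {f \<in> E. f \<subseteq> {Suc m..b}}) = E"
  proof
    fix E assume C: "E \<in> ?C"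
    have "{f \<in> E - {{u, v}}. f \<subseteq> {a..m}} \<union> {f \<in> E - {{u, v}}. f \<subseteq> {Suc m..b}} = E - {{u, v}}"
      by (rule Collect_Un_cover) (use split[OF C] in blast)
    moreover have "{f \<in> E - {{u, v}}. f \<subseteq> {a..m}} = {f \<in> E. f \<subseteq> {a..m}}"
      "{f \<in> E - {{u, v}}. f \<subseteq> {Suc m..b}} = {f \<in> E. f \<subseteq> {Suc m..b}}" using uv by blast+
    ultimately show "?join ({f \<in> E. f \<subseteq> {a..m}}, {f \<in> E. f \<subseteq> {Suc m..b}}) = E"
      using C by auto
  qed
  show "?join ` (?A \<times> ?B) \<subseteq> ?C"
  proof clarify
    fix E1 E2 assume E: "E1 \<in> nctrees a m" "exposed E1 u" "E2 \<in> nctrees (Suc m) b" "exposed E2 v"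
    have sub: "f \<in> E1 \<Longrightarrow> f \<subseteq> {a..m}" "f \<in> E2 \<Longrightarrow> f \<subseteq> {Suc m..b}" for f
      using nctrees_edge_subset[OF E(1)] nctrees_edge_subset[OF E(3)] by blast+
    have nonempty: "f \<noteq> {}" if "f \<in> E1 \<union> E2" for f
      using that E(1,3) by (auto elim: nctrees_edge)
    have cut: "cut_at m (E1 \<union> E2)" using sub by (fastforce simp: cut_at_def)
    have E1: "{f \<in> E1 \<union> E2. f \<subseteq> {..m}} = E1" and E2: "{f \<in> E1 \<union> E2. f \<subseteq> {m<..}} = E2"
      using sub nonempty by fastforce+
    have "tree_on ({a..m} \<union> {Suc m..b}) (insert {u, v} (E1 \<union> E2))"
      by (rule tree_on_bridge_join) (use E assms in \<open>auto simp: nctrees_def\<close>)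
    moreover have "{a..m} \<union> {Suc m..b} = {a..b}" using am by auto
    moreover have "uncrossed (E1 \<union> E2)"
    proof (rule uncrossed_Un[where w = m])
      show "uncrossed E1" "uncrossed E2" using E by (auto simp: nctrees_def)
    qed (use sub in fastforce)+
    then have "uncrossed (insert {u, v} (E1 \<union> E2))"
      by (rule uncrossed_insert[where m = m and E = "E1 \<union> E2", unfolded E1 E2]) (use E assms cut in auto)
    moreover have "cut_at m (insert {u, v} (E1 \<union> E2) - {{u, v}})"
      using cut by (auto simp: cut_at_def)
    ultimately show "insert {u, v} (E1 \<union> E2) \<in> nctrees a b \<and> {u, v} \<in> insert {u, v} (E1 \<union> E2)
        \<and> cut_at m (insert {u, v} (E1 \<union> E2) - {{u, v}})"
      by (simp add: nctrees_def)
  qed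
  show "(\<lambda>E. ({f \<in> E. f \<subseteq> {a..m}}, {f \<in> E. f \<subseteq> {Suc m..b}})) ` ?C \<subseteq> ?A \<times> ?B"
  proof (rule image_subsetI)
    fix E assume C: "E \<in> ?C"
    then have E: "E \<in> nctrees a b" "{u, v} \<in> E" "cut_at m (E - {{u, v}})" by auto
    have tree: "tree_on {a..b} E" and uc: "uncrossed E" using E by (auto simp: nctrees_def)
    have drop: "{f \<in> E - {{u, v}}. f \<subseteq> {a..m}} = {f \<in> E. f \<subseteq> {a..m}}"
      "{f \<in> E - {{u, v}}. f \<subseteq> {Suc m..b}} = {f \<in> E. f \<subseteq> {Suc m..b}}" using uv by blast+
    have "tree_on {a..m} {f \<in> E. f \<subseteq> {a..m}}"
    proof (rule tree_on_subgraph[OF tree])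
      fix i j assume "i \<in> {a..m}" "j \<in> {a..m}"
      then have "conn {f \<in> E - {{u, v}}. f \<subseteq> {a..m}} i j"
        using am split[OF C] cut_conn_iff[OF E(1) am E(3), of i j]
        by (intro conn_restrict[where ?V2.0 = "{Suc m..b}" and w = 0]) auto
      then show "conn {f \<in> E. f \<subseteq> {a..m}} i j" unfolding drop .
    qed (use am in auto)
    moreover have "tree_on {Suc m..b} {f \<in> E. f \<subseteq> {Suc m..b}}"
    proof (rule tree_on_subgraph[OF tree])
      fix i j assume "i \<in> {Suc m..b}" "j \<in> {Suc m..b}"
      then have "conn {f \<in> E - {{u, v}}. f \<subseteq> {Suc m..b}} i j"
        using am split[OF C] cut_conn_iff[OF E(1) am E(3), of i j]
        by (intro conn_restrict[where ?V2.0 = "{a..m}" and w = 0]) auto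
      then show "conn {f \<in> E. f \<subseteq> {Suc m..b}} i j" unfolding drop .
    qed (use am in auto)
    moreover have "uncrossed {f \<in> E. f \<subseteq> {a..m}}" "uncrossed {f \<in> E. f \<subseteq> {Suc m..b}}"
      by (rule uncrossed_mono[OF uc]; blast)+
    moreover have "exposed {f \<in> E. f \<subseteq> {a..m}} u"
      unfolding exposed_def
    proof (intro allI impI notI)
      fix x y assume xy: "{x, y} \<in> {f \<in> E. f \<subseteq> {a..m}}" "x < u \<and> u < y"
      then have "{x, y} \<in> E" "y < v" using assms by auto
      then show False using uc E(2) xy(2) unfolding uncrossed_def by blast
    qed
    moreover have "exposed {f \<in> E. f \<subseteq> {Suc m..b}} v"
      unfolding exposed_def
    proof (intro allI impI notI)
      fix x y assume xy: "{x, y} \<in> {f \<in> E. f \<subseteq> {Suc m..b}}" "x < v \<and> v < y"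
      then have "{x, y} \<in> E" "u < x" using assms by auto
      then show False using uc E(2) xy(2) unfolding uncrossed_def by blast
    qed
    ultimately show "({f \<in> E. f \<subseteq> {a..m}}, {f \<in> E. f \<subseteq> {Suc m..b}}) \<in> ?A \<times> ?B"
      by (simp add: nctrees_def)
  qed
qed

text \<open>
  Paths that cross as curves in the disc must meet at a vertex. Suppose that they do not. The walk from \<open>v\<close> to \<open>q\<close>
  leaves the interval between \<open>u\<close> and \<open>p\<close> along some edge \<open>{c, d}\<close>, which separates \<open>u\<close> from \<open>p\<close> on the
  circle. The walk from \<open>u\<close> to \<open>p\<close> avoids \<open>c\<close> and \<open>d\<close>, so one of its edges crosses \<open>{c, d}\<close>.
\<close>

lemma noncrossing_components:
  assumes "uncrossed F" "conn F u p" "conn F v q" "u < v" "v < p" "p < q"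
  shows "conn F u v"
proof (rule ccontr)
  assume no: "\<not> conn F u v"
  have nouv: "\<not> conn F v u" "\<not> conn F v p" "\<not> conn F u q"
    using no assms(2,3) unfolding conn_iff_component by simp_all
  obtain c d where cd: "{c, d} \<in> F" "u < c \<and> c < p" "\<not> (u < d \<and> d < p)" "conn F v c"
    using assms(3) by (rule conn_leaves[where P = "\<lambda>x. u < x \<and> x < p"]) (use assms in auto)
  have vd: "conn F v d" using cd(4) conn_edge[OF cd(1)] unfolding conn_iff_component by simp
  have "d \<noteq> u" "d \<noteq> p" using vd nouv by auto
  then have d: "d < u \<or> p < d" using cd by auto
  define P where "P = (\<lambda>x. min c d < x \<and> x < max c d)"
  have "P u \<longleftrightarrow> \<not> P p" using d cd assms(4,5) by (auto simp: P_def)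
  then obtain x y where xy: "{x, y} \<in> F" "P x" "\<not> P y" "conn F u x"
  proof (cases "P u")
    case True
    then show thesis using conn_leaves[OF assms(2), of P] that \<open>P u \<longleftrightarrow> \<not> P p\<close> by blast
  next
    case False
    then obtain x y where "{x, y} \<in> F" "P x" "\<not> P y" "conn F p x"
      using conn_leaves[OF conn_sym[OF assms(2)], of P] \<open>P u \<longleftrightarrow> \<not> P p\<close> by blast
    then show thesis using that conn_trans[OF assms(2)] by blast
  qed
  have uy: "conn F u y" using xy(4) conn_edge[OF xy(1)] unfolding conn_iff_component by simp
  have "y \<noteq> c" "y \<noteq> d" using uy cd(4) vd no unfolding conn_iff_component by auto
  then have "y < min c d \<or> max c d < y" using xy(3) by (auto simp: P_def)
  moreover have "{min c d, max c d} \<in> F" using cd(1) by (auto simp: min_def max_def insert_commute)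
  moreover have "{y, x} \<in> F" using xy(1) by (simp add: insert_commute)
  ultimately show False
    using xy(1,2) assms(1)[unfolded uncrossed_def, rule_format, of "min c d" "max c d" x y]
      assms(1)[unfolded uncrossed_def, rule_format, of y x "min c d" "max c d"]
    unfolding P_def by blast
qed

text \<open>
  The splitting of the nodes caused by deleting \<open>e\<close> is recognised at the two boundaries between the
  arcs, one between \<open>m\<close> and \<open>m + 1\<close> and one between \<open>b\<close> and \<open>a\<close>. Since there are only two components, \<open>a\<close> and
  \<open>m\<close> share one of them and \<open>m + 1\<close> and \<open>b\<close> the other, because the alternative would make components cross. For the same
  reason, no edge can run from one arc to the other.
\<close>

lemma cut_iff_ends:
  assumes "E \<in> nctrees a b" "a \<le> m" "m < b" "e \<in> E"
  shows "cut_at m (E - {e}) \<longleftrightarrow> \<not> conn (E - {e}) a b \<and> \<not> conn (E - {e}) m (Suc m)"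
proof
  assume "cut_at m (E - {e})"
  then show "\<not> conn (E - {e}) a b \<and> \<not> conn (E - {e}) m (Suc m)"
    using assms conn_cut[of m "E - {e}"] by fastforce
next
  let ?c = "conn (E - {e})"
  assume no: "\<not> ?c a b \<and> \<not> ?c m (Suc m)"
  have uc: "uncrossed (E - {e})" and tree: "tree_on {a..b} E"
    using assms(1) uncrossed_mono[of E "E - {e}"] by (auto simp: nctrees_def)
  have third: "?c i k" if "\<not> ?c i j" "\<not> ?c j k" "i \<in> {a..b}" "j \<in> {a..b}" "k \<in> {a..b}" for i j k
    using edge_removal_two_classes[OF tree assms(4)] that by blast
  have cross: "?c u v" if "?c u p" "?c v q" "u < v" "v < p" "p < q" for u v p q
    using uc that by (rule noncrossing_components)
  have in_V: "a \<in> {a..b}" "b \<in> {a..b}" "m \<in> {a..b}" "Suc m \<in> {a..b}" using assms by auto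
  have am: "?c a m"
  proof (rule ccontr)
    assume nam: "\<not> ?c a m"
    then have "?c a (Suc m)" "?c m b"
      using third[OF nam, of "Suc m"] third[of m a b] no nam in_V
      unfolding conn_iff_component by metis+
    moreover have "a < m" using nam assms(2) by (cases "a = m") auto
    moreover have "Suc m < b" using \<open>?c a (Suc m)\<close> no assms(3) by (cases "Suc m = b") auto
    ultimately show False using cross[of a "Suc m" m b] nam by auto
  qed
  have mb: "?c (Suc m) b"
  proof (rule ccontr)
    assume "\<not> ?c (Suc m) b"
    then have "?c m b" using third[of m "Suc m" b] no in_V by blast
    then show False using am no unfolding conn_iff_component by simp
  qed
  show "cut_at m (E - {e})"
    unfolding cut_at_def
  proof
    fix f assume f: "f \<in> E - {e}"
    then obtain x y where xy: "f = {x, y}" "a \<le> x" "x < y" "y \<le> b"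
      using nctrees_edge[OF assms(1), of f] by blast
    have "\<not> (x \<le> m \<and> m < y)"
    proof
      assume lt: "x \<le> m \<and> m < y"
      have cxy: "?c x y" using f xy(1) by (intro conn_edge) auto
      have x: "?c x a \<or> ?c x b"
        using third[of a x b] no in_V xy lt unfolding conn_iff_component by fastforce
      then show False
      proof
        assume "?c x a"
        then have my: "?c m y" using am cxy unfolding conn_iff_component by simp
        then have "y \<noteq> Suc m" "y \<noteq> b" using no mb unfolding conn_iff_component by auto
        then have "Suc m < y" "y < b" using lt xy by auto
        then show False using cross[of m y "Suc m" b] my mb no by auto
      next
        assume "?c x b"
        then have "?c x (Suc m)" using mb unfolding conn_iff_component by simp
        moreover have "\<not> ?c a x" using \<open>?c x b\<close> no unfolding conn_iff_component by simp
        moreover from this have "x \<noteq> a" "x \<noteq> m" using am by auto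
        ultimately show False using cross[of a m x "Suc m"] am xy lt by auto
      qed
    qed
    then show "f \<subseteq> {..m} \<or> f \<subseteq> {m<..}" using xy by auto
  qed
qed

section \<open>Counting noncrossing trees and splitting edges\<close>

abbreviation nct :: "nat \<Rightarrow> nat \<Rightarrow> nat" where
  "nct a b \<equiv> card (nctrees a b)"

lemma card_exposed:
  assumes "w \<in> {a..b}"
  shows "card {E \<in> nctrees a b. exposed E w} = nct a w * nct w b"
  using bij_betw_same_card[OF bij_vertex_join, of a w b] assms
  by (simp add: card_cartesian_product)

lemma card_with_bridge:
  assumes "u \<in> {a..m}" "v \<in> {m<..b}"
  shows "card {E \<in> nctrees a b. {u, v} \<in> E \<and> cut_at m (E - {{u, v}})} =
     (nct a u * nct u m) * (nct (Suc m) v * nct v b)"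
  using bij_betw_same_card[OF bij_bridge_join[OF assms]] assms
  by (simp add: card_cartesian_product card_exposed)

text \<open>
  A tree with a marked splitting edge amounts to two trees with a marked exposed vertex each, and marking an exposed
  vertex amounts to writing the tree as two trees glued there.
\<close>

lemma sum_card_cut_edges:
  assumes "a \<le> m" "m < b"
  shows "(\<Sum>E\<in>nctrees a b. card {e \<in> E. cut_at m (E - {e})}) =
     (\<Sum>u=a..m. nct a u * nct u m) * (\<Sum>v=Suc m..b. nct (Suc m) v * nct v b)"
proof -
  let ?R = "\<lambda>E (u, v). {u, v} \<in> E \<and> cut_at m (E - {{u, v}})"
  let ?A = "{a..m} \<times> {Suc m..b}"
  have "card {e \<in> E. cut_at m (E - {e})} = card {p \<in> ?A. ?R E p}"
    if E: "E \<in> nctrees a b" for E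
  proof -
    have "{e \<in> E. cut_at m (E - {e})} = (\<lambda>(u, v). {u, v}) ` {p \<in> ?A. ?R E p}"
    proof (intro equalityI subsetI)
      fix e assume "e \<in> {e \<in> E. cut_at m (E - {e})}"
      then have e: "e \<in> E" "cut_at m (E - {e})" by auto
      obtain u v where uv: "e = {u, v}" "u \<in> {a..m}" "v \<in> {m<..b}"
        using cut_edge[OF E assms e(2)] by blast
      then have "(u, v) \<in> {p \<in> ?A. ?R E p}" using e by auto
      then show "e \<in> (\<lambda>(u, v). {u, v}) ` {p \<in> ?A. ?R E p}" using uv(1) by (auto intro: rev_image_eqI)
    qed auto
    moreover have "inj_on (\<lambda>(u, v). {u, v}) {p \<in> ?A. ?R E p}"
      by (auto simp: inj_on_def doubleton_eq_iff)
    ultimately show ?thesis by (simp add: card_image)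
  qed
  then have "(\<Sum>E\<in>nctrees a b. card {e \<in> E. cut_at m (E - {e})}) =
     (\<Sum>E\<in>nctrees a b. \<Sum>p\<in>{p \<in> ?A. ?R E p}. 1)"
    by simp
  also have "\<dots> = (\<Sum>p\<in>?A. \<Sum>E\<in>{E \<in> nctrees a b. ?R E p}. 1)"
    by (rule sum.swap_restrict) auto
  also have "\<dots> = (\<Sum>(u, v)\<in>?A. (nct a u * nct u m) * (nct (Suc m) v * nct v b))"
  proof (rule sum.cong[OF refl])
    fix p assume "p \<in> ?A"
    then obtain u v where "p = (u, v)" "u \<in> {a..m}" "v \<in> {m<..b}" by auto
    then show "(\<Sum>E\<in>{E \<in> nctrees a b. ?R E p}. 1)
        = (case p of (u, v) \<Rightarrow> (nct a u * nct u m) * (nct (Suc m) v * nct v b))"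
      using card_with_bridge[of u a m v b] by simp
  qed
  also have "\<dots> = (\<Sum>u=a..m. nct a u * nct u m) * (\<Sum>v=Suc m..b. nct (Suc m) v * nct v b)"
    by (simp add: sum_product sum.cartesian_product)
  finally show ?thesis .
qed

text \<open>
  Deleting the edge \<open>{a, k}\<close> leaves an initial segment \<open>{a..j}\<close> as component of \<open>a\<close>. The vertices \<open>a\<close> and \<open>k\<close>
  are exposed in any tree on the respective arcs, so the two trees are arbitrary.
\<close>

lemma card_long_edge:
  assumes "a < k"
  shows "card {E \<in> nctrees a k. {a, k} \<in> E} = (\<Sum>j=a..<k. nct a j * nct (Suc j) k)"
proof -
  let ?e = "{a, k}"
  let ?S = "\<lambda>j. {E \<in> nctrees a k. ?e \<in> E \<and> cut_at j (E - {?e})}"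
  have "{E \<in> nctrees a k. ?e \<in> E} = (\<Union>j\<in>{a..<k}. ?S j)"
  proof (intro equalityI subsetI)
    fix E assume "E \<in> {E \<in> nctrees a k. ?e \<in> E}"
    then have E: "E \<in> nctrees a k" "?e \<in> E" by auto
    then have no: "\<not> conn (E - {?e}) a k"
      by (auto simp: nctrees_def tree_on_iff bridges_def)
    have "\<exists>j. a \<le> j \<and> j < k \<and> conn (E - {?e}) a j \<and> \<not> conn (E - {?e}) a (Suc j)"
    proof (rule ccontr)
      assume *: "\<not> ?thesis"
      have "conn (E - {?e}) a (a + i)" if "a + i \<le> k" for i
        using that by (induction i) (use * in auto)
      from this[of "k - a"] show False using no assms by simp
    qed
    then obtain j where j: "a \<le> j" "j < k" "conn (E - {?e}) a j" "\<not> conn (E - {?e}) a (Suc j)"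
      by blast
    then have "\<not> conn (E - {?e}) j (Suc j)" using conn_trans by metis
    then have "cut_at j (E - {?e})" using cut_iff_ends[OF E(1) j(1,2) E(2)] no by blast
    then show "E \<in> (\<Union>j\<in>{a..<k}. ?S j)" using E j by auto
  qed auto
  moreover have "card (\<Union>j\<in>{a..<k}. ?S j) = (\<Sum>j=a..<k. card (?S j))"
  proof (rule card_UN_disjoint; (intro ballI impI)?)
    fix i j assume ij: "i \<in> {a..<k}" "j \<in> {a..<k}" "i \<noteq> j"
    have no: False if "E \<in> ?S i" "E \<in> ?S j" "i < j" "j < k" "a \<le> i" for E i j
    proof -
      have "conn (E - {?e}) a (Suc i)" using cut_conn_iff[of E a k j ?e a "Suc i"] that by auto
      moreover have "\<not> conn (E - {?e}) a (Suc i)"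
        using cut_conn_iff[of E a k i ?e a "Suc i"] that by auto
      ultimately show False by blast
    qed
    show "?S i \<inter> ?S j = {}"
      using no[of _ i j] no[of _ j i] ij by (cases i j rule: linorder_cases) fastforce+
  qed auto
  moreover have "card (?S j) = nct a j * nct (Suc j) k" if "j \<in> {a..<k}" for j
    using card_with_bridge[of a a j k k] that by (simp add: nctrees_single)
  ultimately show ?thesis by simp
qed

text \<open>
  The tree is cut at the largest neighbour \<open>k\<close> of \<open>a\<close>. It is exposed: an edge over \<open>k\<close> would have to start
  at \<open>a\<close>, against the choice of \<open>k\<close>, or cross \<open>{a, k}\<close>. Being an exposed neighbour of \<open>a\<close> determines \<open>k\<close>, because \<open>{a, k}\<close>
  passes over all smaller candidates.
\<close>

lemma nct_rec:
  assumes "a < b"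
  shows "nct a b = (\<Sum>k\<in>{a<..b}. (\<Sum>j=a..<k. nct a j * nct (Suc j) k) * nct k b)"
proof -
  let ?S = "\<lambda>k. {E \<in> nctrees a b. exposed E k \<and> {a, k} \<in> E}"
  have "nctrees a b = (\<Union>k\<in>{a<..b}. ?S k)"
  proof (intro equalityI subsetI)
    fix E assume E: "E \<in> nctrees a b"
    define K where "K = {k. {a, k} \<in> E}"
    have K: "k \<in> {a<..b}" if "k \<in> K" for k
      using nctrees_edge[OF E, of "{a, k}"] that by (auto simp: K_def doubleton_eq_iff)
    have "finite K" by (rule finite_subset[of _ "{a<..b}"]) (use K in auto)
    have "conn E a b" using assms by (intro nctrees_conn[OF E]) auto
    then obtain c d where "{c, d} \<in> E" "c = a" "d \<noteq> a"
      by (rule conn_leaves[where P = "\<lambda>x. x = a"]) (use assms in auto)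
    then have "K \<noteq> {}" by (auto simp: K_def)
    define k where "k = Max K"
    have k: "k \<in> K" unfolding k_def using \<open>finite K\<close> \<open>K \<noteq> {}\<close> by (rule Max_in)
    have "exposed E k"
      unfolding exposed_def
    proof (intro allI impI notI)
      fix x y assume xy: "{x, y} \<in> E" "x < k \<and> k < y"
      have "a \<le> x" using nctrees_edge_subset[OF E xy(1)] by simp
      moreover have "x \<noteq> a"
      proof
        assume "x = a"
        then have "y \<in> K" using xy by (simp add: K_def)
        then show False using Max_ge[OF \<open>finite K\<close>, of y] xy(2) by (simp add: k_def)
      qed
      moreover have "uncrossed E" using E by (simp add: nctrees_def)
      ultimately show False
        using k xy unfolding K_def uncrossed_def by (metis le_neq_implies_less mem_Collect_eq)
    qed
    then show "E \<in> (\<Union>k\<in>{a<..b}. ?S k)" using E k K[OF k] by (auto simp: K_def)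
  qed auto
  then have "nct a b = card (\<Union>k\<in>{a<..b}. ?S k)" by simp
  also have "\<dots> = (\<Sum>k\<in>{a<..b}. card (?S k))"
  proof (rule card_UN_disjoint; (intro ballI impI)?)
    fix i j assume ij: "i \<in> {a<..b}" "j \<in> {a<..b}" "i \<noteq> j"
    have "\<not> (exposed E i \<and> {a, i} \<in> E \<and> exposed E j \<and> {a, j} \<in> E)" for E
      using ij unfolding exposed_def by (metis greaterThanAtMost_iff linorder_neqE_nat)
    then show "?S i \<inter> ?S j = {}" by blast
  qed auto
  also have "\<dots> = (\<Sum>k\<in>{a<..b}. (\<Sum>j=a..<k. nct a j * nct (Suc j) k) * nct k b)"
  proof (rule sum.cong[OF refl])
    fix k assume k: "k \<in> {a<..b}"
    let ?f = "\<lambda>(E1, E2). E1 \<union> E2 :: nat set set"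
    have bij: "bij_betw ?f (nctrees a k \<times> nctrees k b) {E \<in> nctrees a b. exposed E k}"
      by (rule bij_vertex_join) (use k in auto)
    have notin: "{a, k} \<notin> E" if "E \<in> nctrees k b" for E
      using nctrees_edge_subset[OF that, of "{a, k}"] k by auto
    have "?S k = ?f ` ({E \<in> nctrees a k. {a, k} \<in> E} \<times> nctrees k b)"
    proof (intro equalityI subsetI)
      fix E assume E: "E \<in> ?S k"
      then have "E \<in> ?f ` (nctrees a k \<times> nctrees k b)" using bij by (auto simp: bij_betw_def)
      then obtain E1 E2 where "E1 \<in> nctrees a k" "E2 \<in> nctrees k b" "E = E1 \<union> E2" by auto
      then show "E \<in> ?f ` ({E \<in> nctrees a k. {a, k} \<in> E} \<times> nctrees k b)" using E notin by auto
    next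
      fix E assume E: "E \<in> ?f ` ({E \<in> nctrees a k. {a, k} \<in> E} \<times> nctrees k b)"
      then have "E \<in> ?f ` (nctrees a k \<times> nctrees k b)" "{a, k} \<in> E" by auto
      then show "E \<in> ?S k" using bij by (auto simp: bij_betw_def)
    qed
    moreover have "inj_on ?f ({E \<in> nctrees a k. {a, k} \<in> E} \<times> nctrees k b)"
      by (rule inj_on_subset[OF bij_betw_imp_inj_on[OF bij]]) auto
    ultimately have "card (?S k) = card ({E \<in> nctrees a k. {a, k} \<in> E} \<times> nctrees k b)"
      by (simp add: card_image)
    then show "card (?S k) = (\<Sum>j=a..<k. nct a j * nct (Suc j) k) * nct k b"
      using k by (simp add: card_cartesian_product card_long_edge)
  qed
  finally show ?thesis .
qed

section \<open>The second difference of the total depth\<close>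

lemma int_dist_in:
  assumes "finite E"
  shows "int (dist_in E u v) = (\<Sum>e\<in>E. of_bool (\<not> conn (E - {e}) u v))"
  using assms by (simp add: dist_in_def separators_def sum_of_bool_eq Int_def conj_commute)

text \<open>
  The nodes \<open>b\<close>, \<open>a\<close> and \<open>m\<close>, \<open>m + 1\<close> are neighbours on the circle. The contribution of an edge \<open>e\<close> is
  the mixed difference of the indicator "separated by \<open>e\<close>". It vanishes if \<open>e\<close> does not separate both
  pairs of neighbours, and otherwise \<open>e\<close> splits the nodes into \<open>{a..m}\<close> and \<open>{m + 1..b}\<close>.
\<close>

lemma dist_in_second_difference:
  assumes "E \<in> nctrees a b" "a \<le> m" "m < b"
  shows "int (dist_in E b (Suc m)) + int (dist_in E a m) - int (dist_in E a (Suc m)) - int (dist_in E b m)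
    = - 2 * int (card {e \<in> E. cut_at m (E - {e})})"
proof -
  have fin: "finite E" using assms(1) by (rule finite_nctree)
  have "of_bool (\<not> conn (E - {e}) b (Suc m)) + of_bool (\<not> conn (E - {e}) a m)
      - of_bool (\<not> conn (E - {e}) a (Suc m)) - of_bool (\<not> conn (E - {e}) b m)
      = (- 2 * of_bool (cut_at m (E - {e})) :: int)" if e: "e \<in> E" for e
  proof (cases "cut_at m (E - {e})")
    case True
    show ?thesis
      using True cut_conn_iff[OF assms True, of b "Suc m"] cut_conn_iff[OF assms True, of a m]
        cut_conn_iff[OF assms True, of a "Suc m"] cut_conn_iff[OF assms True, of b m] assms(2,3)
      by simp
  next
    case False
    then have "conn (E - {e}) a b \<or> conn (E - {e}) m (Suc m)"
      using cut_iff_ends[OF assms e] by blast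
    then show ?thesis
      using False unfolding conn_iff_component by auto
  qed
  then have "(\<Sum>e\<in>E. of_bool (\<not> conn (E - {e}) b (Suc m)) + of_bool (\<not> conn (E - {e}) a m)
      - of_bool (\<not> conn (E - {e}) a (Suc m)) - of_bool (\<not> conn (E - {e}) b m))
      = (\<Sum>e\<in>E. - 2 * of_bool (cut_at m (E - {e})) :: int)"
    by (intro sum.cong) auto
  also have "\<dots> = - 2 * int (card {e \<in> E. cut_at m (E - {e})})"
    unfolding sum_distrib_left[symmetric] using fin
    by (simp add: sum_of_bool_eq Int_def conj_commute)
  finally show ?thesis
    by (simp add: int_dist_in[OF fin] sum.distrib sum_subtractf)
qed

text \<open>
  One step of the rotation of the nodes \<open>0, \<dots>, n\<close>, extended by the identity to a permutation of the natural
  numbers, so that images of trees can be taken under an injective map.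
\<close>

definition rot :: "nat \<Rightarrow> nat \<Rightarrow> nat" where
  "rot n k = (if k < n then Suc k else if k = n then 0 else k)"

lemma inj_rot: "inj (rot n)"
  by (auto simp: inj_def rot_def split: if_splits)

lemma rot_image: "rot n ` {0..n} = {0..n}"
  by (rule endo_inj_surj) (auto simp: rot_def intro: inj_on_subset[OF inj_rot])

lemma rot_edge:
  assumes "{a, b} \<in> (`) (rot n) ` E"
  obtains x y where "{x, y} \<in> E" "a = rot n x" "b = rot n y"
proof -
  obtain X where X: "X \<in> E" "{a, b} = rot n ` X" using assms by blast
  then obtain x y where xy: "x \<in> X" "y \<in> X" "a = rot n x" "b = rot n y"
    by (metis imageE insertCI)
  then have "rot n ` X = rot n ` {x, y}" using X by simp
  then have "X = {x, y}" using inj_rot by (simp only: inj_image_eq_iff)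
  then show thesis using that X xy by blast
qed

lemma rot_nctrees:
  assumes "E \<in> nctrees 0 n"
  shows "(`) (rot n) ` E \<in> nctrees 0 n"
proof -
  have "uncrossed ((`) (rot n) ` E)"
    unfolding uncrossed_def
  proof (intro allI impI notI)
    fix a b c d assume e: "{a, b} \<in> (`) (rot n) ` E" "{c, d} \<in> (`) (rot n) ` E"
      and lt: "a < c \<and> c < b \<and> b < d"
    obtain a' b' where ab: "{a', b'} \<in> E" "a = rot n a'" "b = rot n b'" using e(1) by (rule rot_edge)
    obtain c' d' where cd: "{c', d'} \<in> E" "c = rot n c'" "d = rot n d'" using e(2) by (rule rot_edge)
    have "a' \<le> n" "b' \<le> n" "c' \<le> n" "d' \<le> n"
      using nctrees_edge_subset[OF assms] ab(1) cd(1) by fastforce+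
    \<comment> \<open>If \<open>a = 0\<close>, its preimage is \<open>n\<close>, the largest of the four nodes instead of the smallest.\<close>
    then have "(a' < c' \<and> c' < b' \<and> b' < d') \<or> (c' < b' \<and> b' < d' \<and> d' < a')"
      using lt unfolding ab(2,3) cd(2,3) rot_def by (auto split: if_splits)
    moreover have "{b', a'} \<in> E" using ab(1) by (simp add: insert_commute)
    moreover have "uncrossed E" using assms by (simp add: nctrees_def)
    ultimately show False using ab(1) cd(1) unfolding uncrossed_def by blast
  qed
  moreover have "tree_on {0..n} ((`) (rot n) ` E)"
    using tree_on_image[OF inj_rot, of "{0..n}" E n] assms by (simp add: rot_image nctrees_def)
  ultimately show ?thesis by (simp add: nctrees_def)
qed

definition total_dist :: "nat \<Rightarrow> nat \<Rightarrow> nat \<Rightarrow> nat" where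
  "total_dist n u v = (\<Sum>E\<in>nctrees 0 n. dist_in E u v)"

lemma total_dist_rot: "total_dist n (rot n u) (rot n v) = total_dist n u v"
proof -
  let ?f = "\<lambda>E. (`) (rot n) ` E"
  have "inj ((`) (rot n))" by (rule injI) (simp add: inj_image_eq_iff[OF inj_rot])
  then have inj: "inj_on ?f (nctrees 0 n)" by (intro inj_onI) (simp add: inj_image_eq_iff)
  have "?f ` nctrees 0 n = nctrees 0 n"
    by (rule endo_inj_surj) (use rot_nctrees inj in auto)
  then have "bij_betw ?f (nctrees 0 n) (nctrees 0 n)" using inj by (simp add: bij_betw_def)
  then have "total_dist n (rot n u) (rot n v) =
      (\<Sum>E\<in>nctrees 0 n. dist_in (?f E) (rot n u) (rot n v))"
    unfolding total_dist_def by (rule sum.reindex_bij_betw[symmetric])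
  then show ?thesis by (simp add: total_dist_def dist_in_image inj_rot)
qed

text \<open>
  The value \<open>0\<close> at \<open>r = n + 1\<close> is the natural one: counted around the circle, that node is the root again.
\<close>

definition total_depth :: "nat \<Rightarrow> nat \<Rightarrow> int" where
  "total_depth n r = (if r \<le> n then int (total_dist n 0 r) else 0)"

lemma total_depth_0: "total_depth n 0 = 0"
  by (simp add: total_depth_def total_dist_def dist_in_def separators_def)

text \<open>
  By rotation, the nodes \<open>n\<close> and \<open>r - 1\<close> are on average as far apart as \<open>0\<close> and \<open>r\<close>, and \<open>n\<close> and \<open>r\<close>
  as far as \<open>0\<close> and \<open>r + 1\<close>. This turns the second difference into the sum of four distances within
  one tree treated above.
\<close>

lemma total_depth_second_difference:
  assumes "1 \<le> r" "r \<le> n"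
  shows "total_depth n (r + 1) - 2 * total_depth n r + total_depth n (r - 1) =
     - 2 * int ((\<Sum>u=0..r - 1. nct 0 u * nct u (r - 1)) * (\<Sum>v=r..n. nct r v * nct v n))"
proof -
  have r: "Suc (r - 1) = r" using assms by simp
  have "total_dist n 0 r = total_dist n n (r - 1)"
    using total_dist_rot[of n n "r - 1"] assms by (simp add: rot_def split: if_splits)
  moreover have "total_depth n (r + 1) = int (total_dist n n r)"
  proof (cases "r = n")
    case True
    then show ?thesis by (simp add: total_depth_def total_dist_def dist_in_def separators_def)
  next
    case False
    then show ?thesis
      using total_dist_rot[of n n r] assms by (simp add: rot_def total_depth_def)
  qed
  ultimately have "total_depth n (r + 1) - 2 * total_depth n r + total_depth n (r - 1) =
    int (total_dist n n r) + int (total_dist n 0 (r - 1)) - int (total_dist n 0 r)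
      - int (total_dist n n (r - 1))"
    using assms by (simp add: total_depth_def)
  also have "\<dots> = (\<Sum>E\<in>nctrees 0 n. int (dist_in E n r) + int (dist_in E 0 (r - 1))
      - int (dist_in E 0 r) - int (dist_in E n (r - 1)))"
    by (simp add: total_dist_def sum.distrib sum_subtractf)
  also have "\<dots> = (\<Sum>E\<in>nctrees 0 n. - 2 * int (card {e \<in> E. cut_at (r - 1) (E - {e})}))"
    using dist_in_second_difference[of _ 0 n "r - 1", unfolded r] assms
    by (intro sum.cong) auto
  also have "\<dots> = - 2 * int (\<Sum>E\<in>nctrees 0 n. card {e \<in> E. cut_at (r - 1) (E - {e})})"
    by (simp add: sum_distrib_left)
  also have "(\<Sum>E\<in>nctrees 0 n. card {e \<in> E. cut_at (r - 1) (E - {e})}) =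
      (\<Sum>u=0..r - 1. nct 0 u * nct u (r - 1)) * (\<Sum>v=r..n. nct r v * nct v n)"
    using sum_card_cut_edges[of 0 "r - 1" n, unfolded r] assms by simp
  finally show ?thesis .
qed

lemma average_depth_eq:
  assumes "r \<le> n"
  shows "average_depth n r = total_depth n r / nct 0 n"
proof -
  have "depth E r = dist_in E 0 r" if "E \<in> nctrees 0 n" for E
    using that assms by (intro depth_eq_dist_in[of "{0..n}"]) (auto simp: nctrees_def)
  then show ?thesis
    using assms by (simp add: average_depth_def noncrossing_trees_eq total_depth_def total_dist_def)
qed

lemma nct_self [simp]: "nct a a = 1"
  by (simp add: nctrees_single)

section \<open>The ternary generating function\<close>

text \<open>
  The recursion for the number of trees refers to the arc only through its length.
\<close>

lemma nct_shift: "nct a (a + n) = nct 0 n"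
proof (induction n arbitrary: a rule: less_induct)
  case (less n)
  show ?case
  proof (cases "n = 0")
    case False
    have "nct a (a + n) =
        (\<Sum>k\<in>{0<..n}. (\<Sum>j<k. nct 0 j * nct 0 (k - Suc j)) * nct 0 (n - k))" for a
    proof -
      have "nct a (a + n) =
          (\<Sum>k\<in>{a<..a + n}. (\<Sum>j=a..<k. nct a j * nct (Suc j) k) * nct k (a + n))"
        using False by (intro nct_rec) simp
      also have "\<dots> = (\<Sum>k\<in>{0<..n}. (\<Sum>j<k. nct 0 j * nct 0 (k - Suc j)) * nct 0 (n - k))"
      proof (rule sum.reindex_bij_witness[where i = "\<lambda>k. a + k" and j = "\<lambda>k. k - a"])
        fix k assume k: "k \<in> {a<..a + n}"
        have "(\<Sum>j=a..<k. nct a j * nct (Suc j) k) = (\<Sum>j<k - a. nct 0 j * nct 0 (k - a - Suc j))"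
        proof (rule sum.reindex_bij_witness[where i = "\<lambda>j. a + j" and j = "\<lambda>j. j - a"])
          fix j assume j: "j \<in> {a..<k}"
          have "j - a < n" "k - Suc j < n" "k - a - Suc (j - a) = k - Suc j"
            using j k by auto
          then show "nct 0 (j - a) * nct 0 (k - a - Suc (j - a)) = nct a j * nct (Suc j) k"
            using less.IH[of "j - a" a] less.IH[of "k - Suc j" "Suc j"] j k
            by (simp add: Suc_diff_le)
        qed auto
        moreover have "nct k (a + n) = nct 0 (n - (k - a))"
        proof -
          have "n - (k - a) < n" "k + (n - (k - a)) = a + n" using k by auto
          then show ?thesis using less.IH[of "n - (k - a)" k] by simp
        qed
        ultimately show "(\<Sum>j<k - a. nct 0 j * nct 0 (k - a - Suc j)) * nct 0 (n - (k - a)) =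
            (\<Sum>j=a..<k. nct a j * nct (Suc j) k) * nct k (a + n)"
          by simp
      qed auto
      finally show ?thesis .
    qed
    from this[of a] this[of 0] show ?thesis by simp
  qed simp
qed

lemma nct_eq: "a \<le> b \<Longrightarrow> nct a b = nct 0 (b - a)"
  using nct_shift[of a "b - a"] by simp

definition T_fps :: "real fps" where
  "T_fps = Abs_fps (\<lambda>n. real (nct 0 n))"

lemma T_fps_nth: "fps_nth T_fps n = real (nct 0 n)"
  by (simp add: T_fps_def)

lemma T_fps_square_nth: "fps_nth (T_fps ^ 2) n = (\<Sum>i=0..n. real (nct 0 i * nct 0 (n - i)))"
  by (simp add: power2_eq_square fps_mult_nth T_fps_nth)

lemma T_fps_eq: "T_fps = 1 + fps_X * T_fps ^ 3"
proof (rule fps_ext)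
  fix n
  show "fps_nth T_fps n = fps_nth (1 + fps_X * T_fps ^ 3) n"
  proof (cases n)
    case (Suc m)
    have "real (nct 0 n) =
        (\<Sum>k\<in>{0<..n}. (\<Sum>j=0..<k. real (nct 0 j * nct (Suc j) k)) * real (nct k n))"
      using nct_rec[of 0 n] Suc by simp
    also have "\<dots> = (\<Sum>i=0..m. fps_nth (T_fps ^ 2) i * real (nct 0 (m - i)))"
    proof (rule sum.reindex_bij_witness[where i = Suc and j = "\<lambda>k. k - 1"])
      fix k assume k: "k \<in> {0<..n}"
      have "nct (Suc j) k = nct 0 (k - 1 - j)" if "j < k" for j using nct_eq[of "Suc j" k] that by simp
      moreover have "{0..k - 1} = {0..<k}" using k by auto
      moreover have "nct k n = nct 0 (m - (k - 1))" using nct_eq[of k n] k Suc by simp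
      ultimately show "fps_nth (T_fps ^ 2) (k - 1) * real (nct 0 (m - (k - 1))) =
          (\<Sum>j=0..<k. real (nct 0 j * nct (Suc j) k)) * real (nct k n)"
        by (simp add: T_fps_square_nth)
    qed (use Suc in auto)
    also have "\<dots> = fps_nth (T_fps ^ 2 * T_fps) m"
      by (simp add: fps_mult_nth T_fps_nth)
    also have "T_fps ^ 2 * T_fps = T_fps ^ 3" by (simp add: power2_eq_square power3_eq_cube)
    finally show ?thesis using Suc by (simp add: T_fps_nth)
  qed (simp add: T_fps_nth)
qed

text \<open>
  Multiplying \<open>T = 1 + z T\<^sup>3\<close> by \<open>T\<^sup>x\<close> gives a two-term recursion for the coefficients of all powers of \<open>T\<close>,
  which lowers \<open>n\<close> or \<open>x\<close>; the closed form satisfies the same recursion.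
\<close>

lemma T_fps_power_nth:
  assumes "n > 0 \<or> x > 0"
  shows "fps_nth (T_fps ^ x) n = real x * fact (x + 3 * n - 1) / (fact n * fact (x + 2 * n))"
  using assms
proof (induction n arbitrary: x)
  case 0
  then have "fact x = (real x * fact (x - 1) :: real)" by (simp add: fact_reduce)
  then show ?case using 0 by (simp add: fps_power_zeroth T_fps_nth)
next
  case (Suc n)
  note IH = Suc.IH
  show ?case
  proof (induction x)
    case (Suc x)
    have "T_fps ^ Suc x = T_fps ^ x * T_fps" by simp
    also have "\<dots> = T_fps ^ x * (1 + fps_X * T_fps ^ 3)"
      by (rule arg_cong[OF T_fps_eq])
    also have "\<dots> = T_fps ^ x + fps_X * T_fps ^ (x + 3)"
      by (simp add: distrib_left power_add mult_ac)
    finally have "T_fps ^ Suc x = T_fps ^ x + fps_X * T_fps ^ (x + 3)" .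
    then have "fps_nth (T_fps ^ Suc x) (Suc n) = fps_nth (T_fps ^ x) (Suc n) + fps_nth (T_fps ^ (x + 3)) n"
      by simp
    also have "\<dots> = real x * fact (x + 3 * n + 2) / (fact (Suc n) * fact (x + 2 * n + 2))
        + real (x + 3) * fact (x + 3 * n + 2) / (fact n * fact (x + 2 * n + 3))"
      using Suc.IH IH[of "x + 3"] by (simp add: algebra_simps)
    also have "\<dots> = real (Suc x) * fact (x + 3 * n + 3) / (fact (Suc n) * fact (x + 2 * n + 3))"
    proof -
      have "fact (x + 3 * n + 3) = real (x + 3 * n + 3) * fact (x + 3 * n + 2)"
        using fact_Suc[of "x + 3 * n + 2", where ?'a = real] by (simp add: eval_nat_numeral)
      moreover have "fact (x + 2 * n + 3) = real (x + 2 * n + 3) * fact (x + 2 * n + 2)"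
        using fact_Suc[of "x + 2 * n + 2", where ?'a = real] by (simp add: eval_nat_numeral)
      moreover have "fact (Suc n) = real (Suc n) * fact n" by simp
      ultimately show ?thesis
        by (simp add: divide_simps del: fact_Suc) (simp add: algebra_simps)
    qed
    finally have "fps_nth (T_fps ^ Suc x) (Suc n) =
        real (Suc x) * fact (x + 3 * n + 3) / (fact (Suc n) * fact (x + 2 * n + 3))" .
    moreover have "Suc x + 3 * Suc n - 1 = x + 3 * n + 3" "Suc x + 2 * Suc n = x + 2 * n + 3"
      by simp_all
    ultimately show ?case by (simp only:)
  qed simp
qed

lemma nct_closed: "real (nct 0 n) = fact (3 * n) / (fact n * fact (2 * n + 1))"
  using T_fps_power_nth[of n 1] by (simp add: T_fps_nth)

lemma t'_eq: "t' n = fps_nth (T_fps ^ 2) n"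
proof -
  have "t' n = fact (3 * n + 1) / (fact n * fact (2 * n + 1) * real (n + 1))"
    by (simp add: t'_def binomial_fact)
  also have "\<dots> = 2 * fact (3 * n + 1) / (fact n * (2 * real (n + 1) * fact (2 * n + 1)))"
    by (simp only: mult_ac) simp
  also have "2 * real (n + 1) * fact (2 * n + 1) = fact (2 * n + 2)"
    using fact_Suc[of "2 * n + 1", where ?'a = real] by (simp del: fact_Suc)
  also have "2 * fact (3 * n + 1) / (fact n * fact (2 * n + 2)) = fps_nth (T_fps ^ 2) n"
    using T_fps_power_nth[of n 2] by (simp add: add.commute del: fact_Suc)
  finally show ?thesis .
qed

lemma t'_nct: "t' n = (3 * real n + 1) / (real n + 1) * real (nct 0 n)"
proof -
  have "t' n = fact (3 * n + 1) / (fact n * fact (2 * n + 1) * real (n + 1))"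
    by (simp add: t'_def binomial_fact)
  then show ?thesis by (simp add: nct_closed add.commute mult.commute mult.left_commute)
qed

text \<open>
  The number of noncrossing trees on an arc with a marked exposed vertex.
\<close>

lemma sum_nct_split: "real (\<Sum>u=a..b. nct a u * nct u b) = t' (b - a)" if "a \<le> b"
proof -
  have "real (\<Sum>u=a..b. nct a u * nct u b) = (\<Sum>i=0..b - a. real (nct 0 i * nct 0 (b - a - i)))"
    unfolding of_nat_sum
  proof (rule sum.reindex_bij_witness[where i = "\<lambda>i. a + i" and j = "\<lambda>u. u - a"])
    fix u assume "u \<in> {a..b}"
    then show "real (nct 0 (u - a) * nct 0 (b - a - (u - a))) = real (nct a u * nct u b)"
      using nct_eq[of a u] nct_eq[of u b] by simp
  qed (use that in auto)
  then show ?thesis by (simp add: t'_eq T_fps_square_nth)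
qed

lemma total_depth_rec:
  assumes "1 \<le> r" "r \<le> n"
  shows "real_of_int (total_depth n (r + 1)) - 2 * real_of_int (total_depth n r)
     + real_of_int (total_depth n (r - 1)) = - 2 * (t' (r - 1) * t' (n - r))"
proof -
  have "real_of_int (total_depth n (r + 1) - 2 * total_depth n r + total_depth n (r - 1)) =
     - 2 * (real (\<Sum>u=0..r - 1. nct 0 u * nct u (r - 1)) * real (\<Sum>v=r..n. nct r v * nct v n))"
    unfolding total_depth_second_difference[OF assms] by simp
  also have "\<dots> = - 2 * (t' (r - 1) * t' (n - r))"
    using sum_nct_split[of 0 "r - 1"] sum_nct_split[of r n] assms by simp
  finally show ?thesis by simp
qed

lemma second_difference_solution:
  fixes S f :: "nat \<Rightarrow> real"
  assumes "S 0 = 0" "\<And>r. 1 \<le> r \<Longrightarrow> r \<le> n \<Longrightarrow> S (r + 1) - 2 * S r + S (r - 1) = - 2 * f r"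
    and "r \<le> n + 1"
  shows "S r = real r * S 1 - 2 * (\<Sum>i=1..r - 1. real (r - i) * f i)"
  using assms(3)
proof (induction r rule: induct_nat_012)
  case (ge2 r)
  have "(\<Sum>i=1..Suc r. real (Suc (Suc r) - i) * f i) =
      (\<Sum>i=1..Suc r. 2 * (real (Suc r - i) * f i) - real (r - i) * f i) + f (Suc r)"
  proof -
    have "(\<Sum>i=1..r. real (Suc (Suc r) - i) * f i) =
        (\<Sum>i=1..r. 2 * (real (Suc r - i) * f i) - real (r - i) * f i)"
      by (rule sum.cong) (auto simp: of_nat_diff algebra_simps)
    then show ?thesis by simp
  qed
  also have "\<dots> = 2 * (\<Sum>i=1..r. real (Suc r - i) * f i) - (\<Sum>i=1..r - 1. real (r - i) * f i) + f (Suc r)"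
    by (cases r) (simp_all add: sum_subtractf sum_distrib_left)
  finally show ?case
    using ge2 assms(2)[of "Suc r"] by (simp add: algebra_simps)
qed (use assms in auto)

text \<open>
  The condition at \<open>r = n + 1\<close> determines the first value: as the second difference is symmetric under \<open>i \<mapsto> n + 1 - i\<close>,
  it gives the sum of all \<open>t'\<^bsub>i-1\<^esub> t'\<^bsub>n-i\<^esub>\<close>, that is, the coefficient of \<open>z\<^sup>n\<close> in \<open>z T\<^sup>4 = T\<^sup>2 - T\<close>.
\<close>

lemma total_depth_1:
  assumes "n \<ge> 1"
  shows "real_of_int (total_depth n 1) = t' n - real (nct 0 n)"
proof -
  define f where "f i = t' (i - 1) * t' (n - i)" for i
  have sol: "real_of_int (total_depth n r) = real r * real_of_int (total_depth n 1)
      - 2 * (\<Sum>i=1..r - 1. real (r - i) * f i)" if "r \<le> n + 1" for r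
    by (rule second_difference_solution[where n = n])
       (use that total_depth_rec[of _ n] in \<open>auto simp: total_depth_0 f_def\<close>)
  have "(\<Sum>i=1..n. real (n + 1 - i) * f i) = (\<Sum>i=1..n. real i * f i)"
    by (rule sum.reindex_bij_witness[where i = "\<lambda>i. n + 1 - i" and j = "\<lambda>i. n + 1 - i"])
       (auto simp: f_def)
  then have "2 * (\<Sum>i=1..n. real (n + 1 - i) * f i) =
      (\<Sum>i=1..n. real (n + 1 - i) * f i) + (\<Sum>i=1..n. real i * f i)" by simp
  also have "\<dots> = (\<Sum>i=1..n. real (n + 1) * f i)"
    unfolding sum.distrib[symmetric] by (rule sum.cong) (auto simp: of_nat_diff algebra_simps)
  finally have "real (n + 1) * (\<Sum>i=1..n. f i) = real (n + 1) * real_of_int (total_depth n 1)"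
    using sol[of "n + 1"] by (simp add: total_depth_def sum_distrib_left)
  then have "real_of_int (total_depth n 1) = (\<Sum>i=1..n. f i)" by simp
  also have "\<dots> = (\<Sum>i=0..n - 1. t' i * t' (n - 1 - i))"
    by (rule sum.reindex_bij_witness[where i = "\<lambda>i. i + 1" and j = "\<lambda>i. i - 1"])
       (use assms in \<open>auto simp: f_def\<close>)
  also have "\<dots> = fps_nth (T_fps ^ 2 * T_fps ^ 2) (n - 1)"
    by (simp only: fps_mult_nth t'_eq)
  also have "T_fps ^ 2 * T_fps ^ 2 = T_fps ^ 4"
    by (simp flip: power_add)
  also have "fps_nth (T_fps ^ 4) (n - 1) = fps_nth (fps_X * T_fps ^ 4) n"
    using assms by simp
  also have "fps_X * T_fps ^ 4 = (1 + fps_X * T_fps ^ 3) * T_fps - T_fps"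
    by (simp add: algebra_simps eval_nat_numeral)
  also have "\<dots> = T_fps ^ 2 - T_fps"
    by (simp add: T_fps_eq[symmetric] power2_eq_square)
  finally show ?thesis by (simp add: t'_eq T_fps_nth)
qed

lemma total_depth_formula:
  assumes "1 \<le> r" "r \<le> n"
  shows "real_of_int (total_depth n r) = real r * (t' n - real (nct 0 n))
      - 2 * (\<Sum>i=1..r - 1. real (r - i) * (t' (i - 1) * t' (n - i)))"
  using second_difference_solution[of "\<lambda>r. real_of_int (total_depth n r)" n
      "\<lambda>i. t' (i - 1) * t' (n - i)" r] total_depth_rec[of _ n] total_depth_1[of n] assms
  by (simp add: total_depth_0)

section \<open>The limit for a fixed node\<close>

lemma nct_pos: "real (nct 0 n) > 0"
  by (simp add: nct_closed del: fact_Suc)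

lemma nctrees_nonempty [simp]: "nctrees 0 n \<noteq> {}"
  using nct_pos[of n] by auto

lemma nct_ratio: "real (nct 0 n) / real (nct 0 (Suc n)) =
    (real n + 1) * (2 * real n + 3) * (2 * real n + 2) / ((3 * real n + 3) * (3 * real n + 2) * (3 * real n + 1))"
proof -
  have f: "fact (3 * Suc n) = (3 * real n + 3) * (3 * real n + 2) * (3 * real n + 1) * fact (3 * n)"
    "fact (2 * Suc n + 1) = (2 * real n + 3) * (2 * real n + 2) * fact (2 * n + 1)"
    "fact (Suc n) = (real n + 1) * fact n"
    by (simp_all add: eval_nat_numeral algebra_simps)
  show ?thesis
    unfolding nct_closed f by (simp add: divide_simps del: fact_Suc)
qed

lemma nct_ratio_limit: "(\<lambda>n. real (nct 0 n) / real (nct 0 (n + i))) \<longlonglongrightarrow> (4 / 27) ^ i"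
proof (induction i)
  case 0
  then show ?case by simp
next
  case (Suc i)
  have step: "(\<lambda>n. real (nct 0 n) / real (nct 0 (Suc n))) \<longlonglongrightarrow> 4 / 27"
    unfolding nct_ratio by real_asymp
  have "(\<lambda>n. real (nct 0 n) / real (nct 0 (n + i)) *
      (real (nct 0 (n + i)) / real (nct 0 (Suc (n + i))))) \<longlonglongrightarrow> (4 / 27) ^ i * (4 / 27)"
    by (intro tendsto_mult Suc LIMSEQ_ignore_initial_segment[OF step])
  then show ?case by (simp add: mult.commute)
qed

lemma t'_nct_ratio_limit: "(\<lambda>n. t' (n - i) / real (nct 0 n)) \<longlonglongrightarrow> 3 * (4 / 27) ^ i"
proof (rule LIMSEQ_offset)
  have "(\<lambda>n. (3 * real n + 1) / (real n + 1)) \<longlonglongrightarrow> 3" by real_asymp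
  then have "(\<lambda>n. (3 * real n + 1) / (real n + 1) * (real (nct 0 n) / real (nct 0 (n + i))))
      \<longlonglongrightarrow> 3 * (4 / 27) ^ i"
    by (intro tendsto_mult nct_ratio_limit)
  then show "(\<lambda>n. t' (n + i - i) / real (nct 0 (n + i))) \<longlonglongrightarrow> 3 * (4 / 27) ^ i"
    by (simp add: t'_nct)
qed

text \<open>
  In the exact formula for the total depth, \<open>n\<close> occurs only in finitely many quotients
  \<open>t'\<^bsub>n-i\<^esub> / t\<^bsub>n\<^esub>\<close>, where \<open>t\<^bsub>n\<^esub>\<close> is the number of trees; they tend to \<open>3 (4/27)\<^sup>i\<close>.
\<close>

lemma average_depth_fixed:
  assumes "1 \<le> r"
  shows "(\<lambda>n. average_depth n r) \<longlonglongrightarrow>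
    2 * real r - 6 * (\<Sum>i = 1..r - 1. real (r - i) * t' (i - 1) * (4 ^ i / 27 ^ i))"
proof -
  have ev: "\<forall>\<^sub>F n in sequentially. real r * (t' (n - 0) / real (nct 0 n) - 1)
      - 2 * (\<Sum>i=1..r - 1. real (r - i) * (t' (i - 1) * (t' (n - i) / real (nct 0 n)))) = average_depth n r"
    using eventually_ge_at_top[of r]
  proof eventually_elim
    case (elim n)
    have "average_depth n r = (real r * (t' n - real (nct 0 n))
      - 2 * (\<Sum>i=1..r - 1. real (r - i) * (t' (i - 1) * t' (n - i)))) / real (nct 0 n)"
      using average_depth_eq[OF elim] total_depth_formula[OF assms elim] by simp
    also have "\<dots> = real r * (t' n / real (nct 0 n) - 1)
      - 2 * ((\<Sum>i=1..r - 1. real (r - i) * (t' (i - 1) * t' (n - i))) / real (nct 0 n))"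
      using nct_pos[of n] by (simp add: diff_divide_distrib right_diff_distrib)
    also have "\<dots> = real r * (t' n / real (nct 0 n) - 1)
      - 2 * (\<Sum>i=1..r - 1. real (r - i) * (t' (i - 1) * (t' (n - i) / real (nct 0 n))))"
      by (simp only: sum_divide_distrib times_divide_eq_right times_divide_eq_left)
    finally show ?case by simp
  qed
  have lim: "(\<lambda>n. real r * (t' (n - 0) / real (nct 0 n) - 1)
      - 2 * (\<Sum>i=1..r - 1. real (r - i) * (t' (i - 1) * (t' (n - i) / real (nct 0 n)))))
      \<longlonglongrightarrow> real r * (3 * (4 / 27) ^ 0 - 1)
      - 2 * (\<Sum>i=1..r - 1. real (r - i) * (t' (i - 1) * (3 * (4 / 27) ^ i)))"
    by (intro tendsto_intros t'_nct_ratio_limit)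
  have eq: "real r * (3 * (4 / 27) ^ 0 - 1)
      - 2 * (\<Sum>i=1..r - 1. real (r - i) * (t' (i - 1) * (3 * (4 / 27) ^ i)))
      = 2 * real r - 6 * (\<Sum>i = 1..r - 1. real (r - i) * t' (i - 1) * (4 ^ i / 27 ^ i))"
    by (simp add: sum_distrib_left power_divide mult_ac)
  show ?thesis using Lim_transform_eventually[OF lim ev] unfolding eq .
qed

section \<open>Asymptotics of the counting numbers\<close>

lemma Gamma_third_product: "Gamma (1/3 :: real) * Gamma (2/3) = 2 * pi / sqrt 3"
proof -
  have "of_real (Gamma (1/3) * Gamma (2/3)) = Gamma (1/3 :: complex) * Gamma (1 - 1/3)"
    using Gamma_complex_of_real[of "1/3"] Gamma_complex_of_real[of "2/3"] by simp
  also have "\<dots> = of_real pi / sin (of_real pi * (1/3))"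
    by (rule Gamma_reflection_complex)
  also have "\<dots> = of_real (pi / sin (pi / 3))"
    by (simp flip: sin_of_real)
  finally show ?thesis
    by (simp only: of_real_eq_iff sin_60) simp
qed

text \<open>
  Writing the factorials of \<open>3 n\<close> and \<open>2 n\<close> as products over residue classes gives Pochhammer symbols, whose growth is
  the limit that defines the Gamma function.
\<close>

lemma central_trinomial_pochhammer:
  "fact (3 * n) / (fact n * fact (2 * n)) * (4 / 27) ^ n =
     pochhammer (1/3) n * pochhammer (2/3) n / (fact n * pochhammer (1/2 :: real) n)"
proof (induction n)
  case (Suc n)
  have f: "fact (3 * Suc n) = (3 * real n + 3) * (3 * real n + 2) * (3 * real n + 1) * fact (3 * n)"
    "fact (2 * Suc n) = (2 * real n + 2) * (2 * real n + 1) * fact (2 * n)"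
    "fact (Suc n) = (real n + 1) * fact n"
    by (simp_all add: eval_nat_numeral algebra_simps)
  have "fact (3 * Suc n) / (fact (Suc n) * fact (2 * Suc n)) * (4 / 27) ^ Suc n =
      (fact (3 * n) / (fact n * fact (2 * n)) * (4 / 27) ^ n) *
      ((3 * real n + 3) * (3 * real n + 2) * (3 * real n + 1) /
        ((real n + 1) * ((2 * real n + 2) * (2 * real n + 1))) * (4 / 27))"
    unfolding f by (simp add: mult_ac)
  also have "(3 * real n + 3) * (3 * real n + 2) * (3 * real n + 1) /
        ((real n + 1) * ((2 * real n + 2) * (2 * real n + 1))) * (4 / 27) =
        (1/3 + real n) * (2/3 + real n) / ((real n + 1) * (1/2 + real n))"
    by (simp add: divide_simps) (simp add: algebra_simps)
  finally show ?case
    unfolding Suc.IH by (simp add: pochhammer_Suc mult_ac)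
qed simp

text \<open>
  The power of \<open>n\<close> is shifted to \<open>n + 1\<close> to keep the factor nonzero at \<open>n = 0\<close>; the weights
  below then factor exactly.
\<close>

lemma nct_asymptotics:
  "(\<lambda>n. real (nct 0 n) * (4 / 27) ^ n * real (n + 1) powr (3 / 2)) \<longlonglongrightarrow> sqrt 3 / (4 * sqrt pi)"
proof -
  have poch: "pochhammer z n = fact (n - 1) * real n powr z / Gamma_series' z n"
    if "n > 0" "z > 0" for z :: real and n
  proof -
    have "pochhammer z n > 0" using that by (intro pochhammer_pos)
    then show ?thesis using that by (simp add: Gamma_series'_def powr_def mult_ac)
  qed
  let ?G = "\<lambda>n. Gamma_series' (1/2) n / (Gamma_series' (1/3) n * Gamma_series' (2/3) n) :: real"
  have "?G \<longlonglongrightarrow> Gamma (1/2) / (Gamma (1/3) * Gamma (2/3))"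
    by (intro tendsto_intros Gamma_series'_LIMSEQ) (simp only: Gamma_third_product, simp)
  moreover have "(\<lambda>n. real n powr (1/2) * real (n + 1) powr (3/2) / (real n * (2 * real n + 1))) \<longlonglongrightarrow> 1 / 2"
    by real_asymp
  ultimately have lim: "(\<lambda>n. ?G n * (real n powr (1/2) * real (n + 1) powr (3/2) / (real n * (2 * real n + 1))))
      \<longlonglongrightarrow> Gamma (1/2) / (Gamma (1/3) * Gamma (2/3)) * (1 / 2)"
    by (rule tendsto_mult)
  have "\<forall>\<^sub>F n in sequentially. ?G n * (real n powr (1/2) * real (n + 1) powr (3/2) / (real n * (2 * real n + 1)))
      = real (nct 0 n) * (4 / 27) ^ n * real (n + 1) powr (3 / 2)"
    using eventually_gt_at_top[of 0]
  proof eventually_elim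
    case (elim n)
    have Gne: "Gamma_series' z n \<noteq> 0" if "z > 0" for z :: real
      using poch[OF elim that] pochhammer_pos[OF that, of n] by auto
    have "real (nct 0 n) * (4 / 27) ^ n =
        (fact (3 * n) / (fact n * fact (2 * n)) * (4 / 27) ^ n) / (2 * real n + 1)"
      unfolding nct_closed by (simp add: mult_ac)
    also have "\<dots> = (fact (n - 1) * real n powr (1/3)) * (fact (n - 1) * real n powr (2/3)) /
        (fact n * (fact (n - 1) * real n powr (1/2))) * ?G n / (2 * real n + 1)"
      unfolding central_trinomial_pochhammer using elim Gne by (simp add: poch field_simps)
    also have "(fact (n - 1) * real n powr (1/3)) * (fact (n - 1) * real n powr (2/3)) /
        (fact n * (fact (n - 1) * real n powr (1/2))) =
        real n powr (1/3) * real n powr (2/3) / real n powr (1/2) / real n"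
      using elim by (simp add: fact_reduce[of n])
    also have "real n powr (1/3) * real n powr (2/3) / real n powr (1/2) = real n powr (1/2)"
      by (simp add: powr_half_sqrt real_div_sqrt flip: powr_add)
    finally show ?case by (simp add: mult_ac)
  qed
  from Lim_transform_eventually[OF lim this]
  have "(\<lambda>n. real (nct 0 n) * (4 / 27) ^ n * real (n + 1) powr (3 / 2)) \<longlonglongrightarrow>
      Gamma (1/2) / (Gamma (1/3) * Gamma (2/3)) * (1 / 2)" .
  moreover have "Gamma (1/2) / (Gamma (1/3) * Gamma (2/3)) * (1 / 2) = sqrt 3 / (4 * sqrt pi)"
  proof -
    have "sqrt pi / (2 * pi / sqrt 3) = sqrt 3 * (sqrt pi / pi) / 2" by (simp add: mult.commute)
    also have "sqrt pi / pi = 1 / sqrt pi" by (simp add: divide_eq_eq eq_divide_eq)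
    finally show ?thesis unfolding Gamma_third_product Gamma_one_half_real by simp
  qed
  ultimately show ?thesis by simp
qed

lemma t'_asymptotics:
  "(\<lambda>n. t' n * (4 / 27) ^ n * real (n + 1) powr (3 / 2)) \<longlonglongrightarrow> 3 * (sqrt 3 / (4 * sqrt pi))"
proof -
  have "(\<lambda>n. (3 * real n + 1) / (real n + 1)) \<longlonglongrightarrow> 3" by real_asymp
  from tendsto_mult[OF this nct_asymptotics] show ?thesis
    by (simp add: t'_nct mult_ac)
qed

section \<open>Comparing functions by their second differences\<close>

text \<open>
  At the leftmost maximum, a positive value would exceed its left neighbour and be no less than its right one, against
  convexity.
\<close>

lemma convex_max_principle:
  fixes v :: "nat \<Rightarrow> real"
  assumes "v 0 \<le> 0" "v N \<le> 0"
    and "\<And>i. 0 < i \<Longrightarrow> i < N \<Longrightarrow> 2 * v i - v (i + 1) - v (i - 1) \<le> 0"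
    and "r \<le> N"
  shows "v r \<le> 0"
proof (rule ccontr)
  assume "\<not> v r \<le> 0"
  define m where "m = Max (v ` {..N})"
  have max: "v i \<le> m" if "i \<le> N" for i
    unfolding m_def using that by (intro Max_ge) auto
  have "m \<in> v ` {..N}" unfolding m_def by (rule Max_in) auto
  then have ex: "\<exists>i. i \<le> N \<and> v i = m" by auto
  define i where "i = (LEAST i. i \<le> N \<and> v i = m)"
  have i: "i \<le> N" "v i = m" using LeastI_ex[OF ex] by (auto simp: i_def)
  have "m > 0" using max[OF assms(4)] \<open>\<not> v r \<le> 0\<close> by simp
  then have "i \<noteq> 0" "i \<noteq> N" using assms(1,2) i(2) by (metis not_le)+
  then have "0 < i" "i < N" using i by auto
  moreover have "v (i - 1) \<noteq> m"
    using not_less_Least[of "i - 1" "\<lambda>i. i \<le> N \<and> v i = m"] calculation by (auto simp: i_def[symmetric])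
  moreover have "i - 1 \<le> N" "i + 1 \<le> N" using calculation by simp_all
  ultimately show False
    using assms(3)[of i] max[of "i + 1"] max[of "i - 1"] i by auto
qed

text \<open>
  A bounded concave function whose negative second difference is \<open>1\<close> on \<open>{1..M}\<close> and \<open>0\<close> afterwards. It absorbs
  errors of the second difference near the ends of the interval at the price of a constant.
\<close>

definition capped_sum :: "nat \<Rightarrow> nat \<Rightarrow> real" where
  "capped_sum M i = (\<Sum>j=1..M. real (min i j))"

lemma capped_sum_bounds: "0 \<le> capped_sum M i" "capped_sum M i \<le> real M * real M"
proof -
  show "0 \<le> capped_sum M i" by (simp add: capped_sum_def sum_nonneg)
  have "capped_sum M i \<le> (\<Sum>j=1..M. real M)"
    unfolding capped_sum_def by (rule sum_mono) auto
  then show "capped_sum M i \<le> real M * real M" by simp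
qed

lemma capped_sum_second_difference:
  assumes "0 < i"
  shows "2 * capped_sum M i - capped_sum M (i + 1) - capped_sum M (i - 1) = of_bool (i \<le> M)"
proof -
  have "2 * real (min i j) - real (min (i + 1) j) - real (min (i - 1) j) = of_bool (j = i)" for j
    using assms by (cases "j < i"; cases "j = i") (auto simp: min_def of_nat_diff)
  then have "2 * capped_sum M i - capped_sum M (i + 1) - capped_sum M (i - 1) = (\<Sum>j=1..M. of_bool (j = i))"
    unfolding capped_sum_def sum_distrib_left sum_subtractf[symmetric] by simp
  also have "\<dots> = of_bool (i \<le> M)" using assms by (simp add: of_bool_def)
  finally show ?thesis .
qed

text \<open>
  If the second differences of \<open>s\<close> and \<open>g\<close> agree up to a factor near \<open>1\<close> except close to the ends,
  where they are bounded, then \<open>s\<close> and \<open>g\<close> agree up to the same factor and a constant. The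
  constant does not depend on \<open>N\<close>, which makes the comparison uniform.
\<close>

lemma second_difference_comparison:
  fixes s g :: "nat \<Rightarrow> real"
  defines "L \<equiv> \<lambda>v i. 2 * v i - v (i + 1) - v (i - 1 :: nat) :: real"
  assumes "s 0 = 0" "s N = 0" "g 0 = 0" "g N = 0" "\<epsilon> \<ge> 0" "C \<ge> 0"
    and inner: "\<And>i. M < i \<Longrightarrow> i + M < N \<Longrightarrow> \<bar>L s i - L g i\<bar> \<le> \<epsilon> * L g i"
    and outer: "\<And>i. 0 < i \<Longrightarrow> i < N \<Longrightarrow> \<bar>L s i - L g i\<bar> \<le> C"
    and conc: "\<And>i. 0 < i \<Longrightarrow> i < N \<Longrightarrow> L g i \<ge> 0"
    and "r \<le> N"
  shows "\<bar>s r - g r\<bar> \<le> \<epsilon> * g r + 2 * C * (real M * real M)"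
proof -
  define b where "b i = capped_sum M i + capped_sum M (N - i)" for i
  have b: "0 \<le> b i" "b i \<le> 2 * (real M * real M)" for i
    using capped_sum_bounds[of M i] capped_sum_bounds[of M "N - i"] by (auto simp: b_def)
  have Lb: "L b i = of_bool (i \<le> M) + of_bool (N - i \<le> M)" if "0 < i" "i < N" for i
  proof -
    have "N - (i - 1) = N - i + 1" "N - (i + 1) = N - i - 1" using that by auto
    then show ?thesis
      using capped_sum_second_difference[of i M] capped_sum_second_difference[of "N - i" M] that
      by (simp add: L_def b_def)
  qed
  have diff: "\<bar>L s i - L g i\<bar> \<le> \<epsilon> * L g i + C * L b i" if i: "0 < i" "i < N" for i
  proof (cases "M < i \<and> i + M < N")
    case True
    have "0 \<le> C * L b i" using Lb[OF i] \<open>C \<ge> 0\<close> by simp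
    then show ?thesis using inner[of i] True by simp
  next
    case False
    then have "L b i \<ge> 1" using Lb[OF i] i by auto
    then have "C * 1 \<le> C * L b i" using \<open>C \<ge> 0\<close> by (rule mult_left_mono)
    moreover have "0 \<le> \<epsilon> * L g i" using conc[OF i] \<open>\<epsilon> \<ge> 0\<close> by simp
    ultimately show ?thesis using outer[OF i] by simp
  qed
  \<comment> \<open>Both \<open>s - g\<close> and \<open>g - s\<close> stay below the barrier \<open>\<epsilon> g + C b\<close>, since the differences from it are convex.\<close>
  have sides: "\<sigma> * (s r - g r) - (\<epsilon> * g r + C * b r) \<le> 0" if \<sigma>: "\<sigma> = 1 \<or> \<sigma> = -1" for \<sigma>
  proof (rule convex_max_principle[where N = N])
    show "\<sigma> * (s 0 - g 0) - (\<epsilon> * g 0 + C * b 0) \<le> 0" "\<sigma> * (s N - g N) - (\<epsilon> * g N + C * b N) \<le> 0"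
      using assms(2-5) b(1) \<open>C \<ge> 0\<close> by simp_all
    fix i assume i: "0 < i" "i < N"
    have "\<sigma> * (L s i - L g i) - (\<epsilon> * L g i + C * L b i) \<le> 0" using diff[OF i] \<sigma> by auto
    then show "2 * (\<sigma> * (s i - g i) - (\<epsilon> * g i + C * b i))
        - (\<sigma> * (s (i + 1) - g (i + 1)) - (\<epsilon> * g (i + 1) + C * b (i + 1)))
        - (\<sigma> * (s (i - 1) - g (i - 1)) - (\<epsilon> * g (i - 1) + C * b (i - 1))) \<le> 0"
      by (simp add: L_def algebra_simps)
  qed (rule \<open>r \<le> N\<close>)
  have "C * b r \<le> C * (2 * (real M * real M))" using b(2) \<open>C \<ge> 0\<close> by (rule mult_left_mono)
  then show ?thesis using sides[of 1] sides[of "-1"] by simp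
qed

section \<open>The square root profile\<close>

text \<open>
  Here \<open>h\<close>, \<open>p\<close>, \<open>q\<close> are the values of the parabola \<open>i (N - i)\<close> at three consecutive points, with \<open>j = N - i\<close>.
  Rationalising twice, with \<open>(h + 1)\<^sup>2 - p q = N\<^sup>2\<close> in the second step, leaves no cancellation behind.
\<close>

lemma sqrt_second_difference:
  fixes i j :: nat
  assumes "i \<ge> 1" "j \<ge> 1"
  defines "h \<equiv> real i * real j" and "p \<equiv> (real i + 1) * (real j - 1)" and "q \<equiv> (real i - 1) * (real j + 1)"
  shows "2 * sqrt h - sqrt p - sqrt q =
    2 * (real i + real j)\<^sup>2 / ((h + 1 + sqrt (p * q)) * (2 * sqrt h + sqrt p + sqrt q))"
proof -
  have h: "h \<ge> 1" using assms mult_mono[of 1 "real i" 1 "real j"] by (simp add: h_def)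
  have pq: "p \<ge> 0" "q \<ge> 0" using assms by (simp_all add: p_def q_def)
  define P Q H R where "P = sqrt p" and "Q = sqrt q" and "H = sqrt h" and "R = sqrt (p * q)"
  have sq: "P\<^sup>2 = p" "Q\<^sup>2 = q" "H\<^sup>2 = h" "R\<^sup>2 = p * q" "R = P * Q" 
    using h pq by (simp_all add: P_def Q_def H_def R_def real_sqrt_mult power_mult_distrib)
  have nn: "P \<ge> 0" "Q \<ge> 0" "H > 0" "R \<ge> 0" using h pq by (simp_all add: P_def Q_def H_def R_def)
  have "(2 * H - P - Q) * (2 * H + P + Q) = 4 * h - (p + q + 2 * R)"
    using sq by (simp add: power2_eq_square algebra_simps)
  also have "\<dots> = 2 * (h + 1 - R)" by (simp add: h_def p_def q_def algebra_simps)
  finally have 1: "(2 * H - P - Q) * (2 * H + P + Q) = 2 * (h + 1 - R)" .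
  have "(h + 1 - R) * (h + 1 + R) = (h + 1)\<^sup>2 - p * q"
    using sq(4) by (simp add: power2_eq_square algebra_simps)
  also have "\<dots> = (real i + real j)\<^sup>2"
    by (simp add: h_def p_def q_def power2_eq_square algebra_simps)
  finally have 2: "(h + 1 - R) * (h + 1 + R) = (real i + real j)\<^sup>2" .
  have "(2 * H - P - Q) * ((h + 1 + R) * (2 * H + P + Q)) =
      ((2 * H - P - Q) * (2 * H + P + Q)) * (h + 1 + R)" by (simp add: mult_ac)
  also have "\<dots> = 2 * ((h + 1 - R) * (h + 1 + R))" unfolding 1 by simp
  finally have "(2 * H - P - Q) * ((h + 1 + R) * (2 * H + P + Q)) = 2 * (real i + real j)\<^sup>2"
    unfolding 2 .
  moreover have "(h + 1 + R) * (2 * H + P + Q) > 0" using h nn by (intro mult_pos_pos) auto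
  ultimately have "2 * H - P - Q = 2 * (real i + real j)\<^sup>2 / ((h + 1 + R) * (2 * H + P + Q))"
    by (metis less_irrefl nonzero_eq_divide_eq)
  then show ?thesis by (simp only: P_def Q_def H_def R_def)
qed

text \<open>
  The quotient of the negative second difference of \<open>sqrt (i (N - i))\<close>, with \<open>j = N - i\<close>, and its order of
  magnitude \<open>N\<^sup>2 / (i j) powr (3 / 2)\<close>. Written in \<open>1 / i\<close> and \<open>1 / j\<close>, its limit is visible.
\<close>

definition curvature :: "nat \<Rightarrow> nat \<Rightarrow> real" where
  "curvature i j = (let x = 1 / real i; y = 1 / real j in
     2 / ((1 + x * y + sqrt ((1 - x\<^sup>2) * (1 - y\<^sup>2))) *
          (2 + sqrt ((1 + x) * (1 - y)) + sqrt ((1 - x) * (1 + y)))))"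

lemma curvature_bounds:
  assumes "i \<ge> 1" "j \<ge> 1"
  shows "curvature i j > 0" "curvature i j \<le> 1"
proof -
  define x y where "x = 1 / real i" and "y = 1 / real j"
  have xy: "0 < x" "x \<le> 1" "0 < y" "y \<le> 1" using assms by (auto simp: x_def y_def)
  have sq: "x\<^sup>2 \<le> 1" "y\<^sup>2 \<le> 1" using xy by (auto intro: power_le_one)
  have "0 \<le> sqrt ((1 - x\<^sup>2) * (1 - y\<^sup>2))" "0 \<le> sqrt ((1 + x) * (1 - y))" "0 \<le> sqrt ((1 - x) * (1 + y))"
    "0 < x * y" using xy sq by simp_all
  then have *: "1 \<le> 1 + x * y + sqrt ((1 - x\<^sup>2) * (1 - y\<^sup>2))"
    "2 \<le> 2 + sqrt ((1 + x) * (1 - y)) + sqrt ((1 - x) * (1 + y))" by linarith+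
  then have "1 * 2 \<le> (1 + x * y + sqrt ((1 - x\<^sup>2) * (1 - y\<^sup>2))) *
      (2 + sqrt ((1 + x) * (1 - y)) + sqrt ((1 - x) * (1 + y)))" by (intro mult_mono) auto
  then show "curvature i j > 0" "curvature i j \<le> 1"
    by (auto simp: curvature_def Let_def x_def[symmetric] y_def[symmetric])
qed

lemma sqrt_profile_curvature:
  assumes "i \<ge> 1" "j \<ge> 1"
  shows "2 * sqrt (real i * real j) - sqrt ((real i + 1) * (real j - 1)) - sqrt ((real i - 1) * (real j + 1))
    = (real i + real j)\<^sup>2 / (real i * real j) powr (3 / 2) * curvature i j"
proof -
  define h p q where "h = real i * real j" and "p = (real i + 1) * (real j - 1)"
    and "q = (real i - 1) * (real j + 1)"
  define x y where "x = 1 / real i" and "y = 1 / real j"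
  have h: "h > 0" using assms by (simp add: h_def)
  have ps: "p = h * ((1 + x) * (1 - y))" and qs: "q = h * ((1 - x) * (1 + y))"
    using assms by (simp_all add: h_def p_def q_def x_def y_def field_simps)
  have pq: "p * q = h\<^sup>2 * ((1 - x\<^sup>2) * (1 - y\<^sup>2))"
    unfolding ps qs by (simp add: power2_eq_square algebra_simps)
  have hxy: "h * (x * y) = 1" using assms by (simp add: h_def x_def y_def)
  have "2 * sqrt h - sqrt p - sqrt q =
      2 * (real i + real j)\<^sup>2 / ((h + 1 + sqrt (p * q)) * (2 * sqrt h + sqrt p + sqrt q))"
    unfolding h_def p_def q_def by (rule sqrt_second_difference[OF assms])
  also have "(h + 1 + sqrt (p * q)) = h * (1 + x * y + sqrt ((1 - x\<^sup>2) * (1 - y\<^sup>2)))"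
    unfolding pq real_sqrt_mult[of "h\<^sup>2"] using h hxy by (simp add: distrib_left)
  also have "2 * sqrt h + sqrt p + sqrt q =
      sqrt h * (2 + sqrt ((1 + x) * (1 - y)) + sqrt ((1 - x) * (1 + y)))"
    unfolding ps qs real_sqrt_mult[of h] by (simp add: distrib_left)
  also have "2 * (real i + real j)\<^sup>2 / (h * (1 + x * y + sqrt ((1 - x\<^sup>2) * (1 - y\<^sup>2))) *
      (sqrt h * (2 + sqrt ((1 + x) * (1 - y)) + sqrt ((1 - x) * (1 + y))))) =
      (real i + real j)\<^sup>2 / (h * sqrt h) * curvature i j"
    by (simp add: curvature_def Let_def x_def y_def mult_ac)
  also have "h * sqrt h = h powr (3 / 2)"
    using h powr_add[of h 1 "1/2"] by (simp add: powr_half_sqrt)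
  finally show ?thesis by (simp only: h_def p_def q_def)
qed

definition depth_const :: real where
  "depth_const = 8 / sqrt (3 * pi)"

text \<open>
  The asymptotic shape of the average depth; \<open>n + 1\<close> in place of \<open>n\<close> gives it the exact zeros at \<open>0\<close> and \<open>n + 1\<close>
  and the symmetry of the average depth.
\<close>

definition depth_profile :: "nat \<Rightarrow> nat \<Rightarrow> real" where
  "depth_profile n i = depth_const * sqrt (real i * real (n + 1 - i) / real (n + 1))"

text \<open>
  The common order of magnitude of the second differences of the average depth and of the profile.
\<close>

definition weight :: "nat \<Rightarrow> nat \<Rightarrow> real" where
  "weight i j = ((real i + real j) / (real i * real j)) powr (3 / 2)"

text \<open>
  The negative second difference of the average depth, \<open>2 t'\<^bsub>i-1\<^esub> t'\<^bsub>j-1\<^esub> / t\<^bsub>i+j-1\<^esub>\<close>, divided by the weight.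
  The powers of \<open>4/27\<close> cancel up to one factor, which combines with \<open>2\<close> to \<open>8/27\<close>; each
  bracket is a convergent sequence.
\<close>

definition split_ratio :: "nat \<Rightarrow> nat \<Rightarrow> real" where
  "split_ratio i j =
     8 / 27 * (t' (i - 1) * (4 / 27) ^ (i - 1) * real (i - 1 + 1) powr (3 / 2)) *
      (t' (j - 1) * (4 / 27) ^ (j - 1) * real (j - 1 + 1) powr (3 / 2)) /
      (real (nct 0 (i + j - 1)) * (4 / 27) ^ (i + j - 1) * real (i + j - 1 + 1) powr (3 / 2))"

lemma depth_const_pos: "depth_const > 0"
  by (simp add: depth_const_def)

lemma weight_bounds:
  assumes "i \<ge> 1" "j \<ge> 1"
  shows "0 < weight i j" "weight i j \<le> 2 powr (3 / 2)"
proof -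
  have e: "(real i + real j) / (real i * real j) = 1 / real i + 1 / real j"
    using assms by (simp add: field_simps)
  have "1 / real i \<le> 1" "1 / real j \<le> 1" "1 / real i > 0" "1 / real j > 0" using assms by auto
  then have "0 < 1 / real i + 1 / real j" "1 / real i + 1 / real j \<le> 2" by linarith+
  then show "0 < weight i j" "weight i j \<le> 2 powr (3 / 2)"
    unfolding weight_def e powr_gt_zero by (linarith, intro powr_mono2, auto)
qed

lemma depth_profile_second_difference:
  assumes "0 < i" "i < n + 1"
  shows "2 * depth_profile n i - depth_profile n (i + 1) - depth_profile n (i - 1) =
     depth_const * curvature i (n + 1 - i) * weight i (n + 1 - i)"
proof -
  define j where "j = n + 1 - i"
  have ij: "i \<ge> 1" "j \<ge> 1" and n: "n + 1 = i + j" using assms by (auto simp: j_def)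
  have parts: "real (n + 1 - (i + 1)) = real j - 1" "real (n + 1 - (i - 1)) = real j + 1"
    "real (i - 1) = real i - 1" "real (i + 1) = real i + 1" "real (n + 1) = real i + real j"
    "real (n + 1 - i) = real j"
    using ij n by (auto simp: of_nat_diff)
  let ?N = "real i + real j"
  have N: "?N > 0" using ij by simp
  have "2 * depth_profile n i - depth_profile n (i + 1) - depth_profile n (i - 1) =
      depth_const / sqrt ?N * (2 * sqrt (real i * real j) - sqrt ((real i + 1) * (real j - 1))
        - sqrt ((real i - 1) * (real j + 1)))"
    unfolding depth_profile_def parts real_sqrt_divide
    by (simp add: diff_divide_distrib right_diff_distrib)
  also have "\<dots> = depth_const * curvature i j * (?N\<^sup>2 / sqrt ?N / (real i * real j) powr (3 / 2))"
    unfolding sqrt_profile_curvature[OF ij] by simp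
  also have "?N\<^sup>2 / sqrt ?N = ?N powr (3 / 2)"
  proof -
    have "?N powr (3 / 2) * sqrt ?N = ?N powr 2"
      using N by (simp flip: powr_half_sqrt powr_add)
    also have "\<dots> = ?N\<^sup>2" using N powr_realpow[of ?N 2] by simp
    finally show ?thesis using N by (simp add: divide_eq_eq)
  qed
  also have "?N powr (3 / 2) / (real i * real j) powr (3 / 2) = weight i j"
    using N ij by (simp add: weight_def powr_divide)
  finally show ?thesis by (simp add: j_def)
qed

lemma mean_depth_second_difference:
  assumes "0 < i" "i < n + 1"
  defines "s \<equiv> \<lambda>i. real_of_int (total_depth n i) / real (nct 0 n)"
  shows "2 * s i - s (i + 1) - s (i - 1) = split_ratio i (n + 1 - i) * weight i (n + 1 - i)"
proof -
  define j where "j = n + 1 - i"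
  have ij: "i \<ge> 1" "j \<ge> 1" and n: "n + 1 = i + j" using assms by (auto simp: j_def)
  define X where "X = (4 / 27 :: real)"
  have X: "X > 0" by (simp add: X_def)
  have parts: "real (i - 1 + 1) = real i" "real (j - 1 + 1) = real j" "real (i + j - 1 + 1) = real i + real j"
    "n = i + j - 1" "n - i = j - 1"
    using ij n by auto
  have "2 * s i - s (i + 1) - s (i - 1) =
      - (real_of_int (total_depth n (i + 1)) - 2 * real_of_int (total_depth n i)
         + real_of_int (total_depth n (i - 1))) / real (nct 0 n)"
    by (simp add: s_def diff_divide_distrib add_divide_distrib)
  also have "\<dots> = 2 * (t' (i - 1) * t' (j - 1)) / real (nct 0 (i + j - 1))"
    using total_depth_rec[of i n] assms parts by simp
  also have "\<dots> = split_ratio i j * weight i j"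
  proof -
    have pw: "(real i + real j) powr (3/2) > 0" "real i powr (3/2) > 0" "real j powr (3/2) > 0"
      using ij by auto
    have w: "weight i j = (real i + real j) powr (3/2) / (real i powr (3/2) * real j powr (3/2))"
      using ij by (simp add: weight_def powr_divide powr_mult)
    have pow: "X ^ (i + j - 1) = X ^ (i - 1) * X ^ (j - 1) * X"
      using ij by (cases i; cases j) (simp_all add: power_add)
    have key: "2 * (a * b) / T = 2 * X * (a * u * P) * (b * v * Q) / (T * (u * v * X) * R) * (R / (P * Q))"
      if "T > 0" "u > 0" "v > 0" "P > 0" "Q > 0" "R > 0" for a b T u v P Q R
      using that X by simp
    have const: "8 / 27 = 2 * X" by (simp add: X_def)
    show ?thesis
      unfolding split_ratio_def parts(1-3) w X_def[symmetric] const pow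
      by (intro key pw nct_pos zero_less_power X)
  qed
  finally show ?thesis by (simp add: j_def)
qed

lemma curvature_limit:
  "((\<lambda>(i, j). curvature i j) \<longlongrightarrow> 1 / 4) (sequentially \<times>\<^sub>F sequentially)"
proof -
  have "((\<lambda>p. 1 / real (fst p)) \<longlongrightarrow> 0) (sequentially \<times>\<^sub>F sequentially)"
    by (rule filterlim_compose[OF lim_1_over_n filterlim_fst])
  moreover have "((\<lambda>p. 1 / real (snd p)) \<longlongrightarrow> 0) (sequentially \<times>\<^sub>F sequentially)"
    by (rule filterlim_compose[OF lim_1_over_n filterlim_snd])
  ultimately have "((\<lambda>p. curvature (fst p) (snd p)) \<longlongrightarrow> 2 / ((1 + 0 * 0 + sqrt ((1 - 0\<^sup>2) * (1 - 0\<^sup>2))) *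
          (2 + sqrt ((1 + 0) * (1 - 0)) + sqrt ((1 - 0) * (1 + 0))))) (sequentially \<times>\<^sub>F sequentially)"
    unfolding curvature_def Let_def by (intro tendsto_intros) auto
  then show ?thesis by (simp add: case_prod_unfold)
qed

text \<open>
  The constant in the profile is chosen for this limit to agree with that of \<open>depth_const * curvature\<close>.
\<close>

lemma split_ratio_limit:
  "((\<lambda>(i, j). split_ratio i j) \<longlongrightarrow> depth_const / 4) (sequentially \<times>\<^sub>F sequentially)"
proof -
  let ?F = "sequentially \<times>\<^sub>F sequentially :: (nat \<times> nat) filter"
  let ?c = "sqrt 3 / (4 * sqrt pi)"
  have i: "filterlim (\<lambda>p. fst p - 1) sequentially ?F"
    by (rule filterlim_compose[OF filterlim_minus_const_nat_at_top filterlim_fst])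
  have j: "filterlim (\<lambda>p. snd p - 1) sequentially ?F"
    by (rule filterlim_compose[OF filterlim_minus_const_nat_at_top filterlim_snd])
  have ij: "filterlim (\<lambda>p. fst p + snd p - 1) sequentially ?F"
    by (rule filterlim_at_top_mono[OF i always_eventually]) (intro allI diff_le_mono le_add1)
  have "((\<lambda>p. split_ratio (fst p) (snd p)) \<longlongrightarrow> 8 / 27 * (3 * ?c) * (3 * ?c) / ?c) ?F"
    unfolding split_ratio_def
    by (intro tendsto_intros filterlim_compose[OF t'_asymptotics i] filterlim_compose[OF t'_asymptotics j]
        filterlim_compose[OF nct_asymptotics ij]) auto
  moreover have "8 / 27 * (3 * ?c) * (3 * ?c) / ?c = depth_const / 4"
  proof -
    have "8 / 27 * (3 * c) * (3 * c) / c = 8 / 3 * c" for c :: real by simp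
    then have "8 / 27 * (3 * ?c) * (3 * ?c) / ?c = 8 / 3 * ?c" .
    also have "\<dots> = 8 / (sqrt 3 * sqrt pi) / 4"
    proof -
      define u v where "u = sqrt (3 :: real)" and "v = sqrt pi"
      have "u * u = 3" "u > 0" "v > 0" by (simp_all add: u_def v_def)
      then have "8 / 3 * (u / (4 * v)) = 8 / (u * v) / 4" by (simp add: divide_simps)
      then show ?thesis by (simp only: u_def v_def)
    qed
    finally show ?thesis by (simp only: depth_const_def real_sqrt_mult)
  qed
  ultimately show ?thesis by (simp only: case_prod_unfold)
qed

lemma split_ratio_near_curvature:
  assumes "\<epsilon> > 0"
  obtains M where "\<And>i j. M < i \<Longrightarrow> M < j \<Longrightarrow>
    \<bar>split_ratio i j - depth_const * curvature i j\<bar> \<le> \<epsilon> * (depth_const * curvature i j)"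
proof -
  let ?F = "sequentially \<times>\<^sub>F sequentially :: (nat \<times> nat) filter"
  have "((\<lambda>p. \<bar>split_ratio (fst p) (snd p) - depth_const * curvature (fst p) (snd p)\<bar>
      - \<epsilon> * (depth_const * curvature (fst p) (snd p))) \<longlongrightarrow>
      \<bar>depth_const / 4 - depth_const * (1 / 4)\<bar> - \<epsilon> * (depth_const * (1 / 4))) ?F"
    by (intro tendsto_intros split_ratio_limit[unfolded case_prod_unfold]
        curvature_limit[unfolded case_prod_unfold])
  moreover have "\<bar>depth_const / 4 - depth_const * (1 / 4)\<bar> - \<epsilon> * (depth_const * (1 / 4)) < 0"
    using assms depth_const_pos by simp
  ultimately have "\<forall>\<^sub>F p in ?F. \<bar>split_ratio (fst p) (snd p) - depth_const * curvature (fst p) (snd p)\<bar>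
      - \<epsilon> * (depth_const * curvature (fst p) (snd p)) < 0"
    by (rule order_tendstoD(2))
  then obtain M where "\<forall>m\<ge>M. \<forall>n\<ge>M. \<bar>split_ratio n m - depth_const * curvature n m\<bar>
      - \<epsilon> * (depth_const * curvature n m) < 0"
    unfolding eventually_prod_sequentially by auto
  then show thesis by (intro that[of M]) (simp add: less_imp_le)
qed

lemma split_ratio_bounded:
  obtains B where "\<And>i j. \<bar>split_ratio i j\<bar> \<le> B"
proof -
  let ?a = "\<lambda>n. t' n * (4 / 27) ^ n * real (n + 1) powr (3 / 2)"
  let ?b = "\<lambda>n. 1 / (real (nct 0 n) * (4 / 27) ^ n * real (n + 1) powr (3 / 2))"
  have "convergent ?a" using t'_asymptotics by (auto simp: convergent_def)
  then obtain Ba where Ba: "Ba > 0" "\<And>n. \<bar>?a n\<bar> \<le> Ba"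
    by (auto dest!: convergent_imp_Bseq elim!: BseqE)
  have "?b \<longlonglongrightarrow> 1 / (sqrt 3 / (4 * sqrt pi))"
    by (intro tendsto_divide tendsto_const nct_asymptotics) auto
  then have "convergent ?b" by (auto simp: convergent_def)
  then obtain Bb where Bb: "Bb > 0" "\<And>n. \<bar>?b n\<bar> \<le> Bb"
    by (auto dest!: convergent_imp_Bseq elim!: BseqE)
  have "\<bar>split_ratio i j\<bar> \<le> 8 / 27 * (Ba * Ba * Bb)" for i j
  proof -
    have "\<bar>split_ratio i j\<bar> = 8 / 27 * (\<bar>?a (i - 1)\<bar> * \<bar>?a (j - 1)\<bar> * \<bar>?b (i + j - 1)\<bar>)"
      by (simp add: split_ratio_def abs_mult)
    also have "\<dots> \<le> 8 / 27 * (Ba * Ba * Bb)"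
      using Ba Bb by (intro mult_left_mono mult_mono) auto
    finally show ?thesis .
  qed
  then show thesis by (rule that)
qed

text \<open>
  Far from both ends the second differences of the average depth and the profile have quotient close to \<open>1\<close>, since
  the two ratios have the same limit; near the ends both are bounded.
\<close>

lemma average_depth_near_profile:
  assumes "\<epsilon> > 0"
  obtains D where "\<And>n r. r \<le> n \<Longrightarrow>
    \<bar>average_depth n r - depth_profile n r\<bar> \<le> \<epsilon> * depth_profile n r + D"
proof -
  obtain M where M: "\<And>i j. M < i \<Longrightarrow> M < j \<Longrightarrow>
    \<bar>split_ratio i j - depth_const * curvature i j\<bar> \<le> \<epsilon> * (depth_const * curvature i j)"
    using split_ratio_near_curvature[OF assms] by blast
  obtain B where B: "\<And>i j. \<bar>split_ratio i j\<bar> \<le> B" using split_ratio_bounded by blast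
  define C where "C = (B + depth_const) * 2 powr (3 / 2)"
  have "B \<ge> 0" using B[of 0 0] by linarith
  then have "C \<ge> 0" using depth_const_pos by (simp add: C_def)
  have "\<bar>average_depth n r - depth_profile n r\<bar> \<le> \<epsilon> * depth_profile n r + 2 * C * (real M * real M)"
    if "r \<le> n" for n r
  proof -
    define s where "s i = real_of_int (total_depth n i) / real (nct 0 n)" for i
    have "\<bar>s r - depth_profile n r\<bar> \<le> \<epsilon> * depth_profile n r + 2 * C * (real M * real M)"
    proof (rule second_difference_comparison[where N = "n + 1"])
      have "total_depth n (n + 1) = 0" by (simp add: total_depth_def)
      then show "s 0 = 0" "s (n + 1) = 0" "depth_profile n 0 = 0" "depth_profile n (n + 1) = 0"
        using total_depth_0[of n] by (simp_all add: s_def depth_profile_def)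
      fix i
      define j where "j = n + 1 - i"
      have Ls: "2 * s i - s (i + 1) - s (i - 1) = split_ratio i j * weight i j"
        and Lg: "2 * depth_profile n i - depth_profile n (i + 1) - depth_profile n (i - 1) =
          depth_const * curvature i j * weight i j" if "0 < i" "i < n + 1"
        using mean_depth_second_difference[OF that] depth_profile_second_difference[OF that]
        by (simp_all add: s_def j_def)
      have pos: "i \<ge> 1" "j \<ge> 1" if "0 < i" "i < n + 1" using that by (auto simp: j_def)
      {
        assume i: "M < i" "i + M < n + 1"
        then have range: "0 < i" "i < n + 1" and "M < j" by (auto simp: j_def)
        have "\<bar>split_ratio i j * weight i j - depth_const * curvature i j * weight i j\<bar> =
            \<bar>split_ratio i j - depth_const * curvature i j\<bar> * weight i j"
          using weight_bounds(1)[OF pos[OF range]] by (simp add: abs_mult flip: left_diff_distrib)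
        also have "\<dots> \<le> \<epsilon> * (depth_const * curvature i j) * weight i j"
          using M[OF i(1) \<open>M < j\<close>] weight_bounds(1)[OF pos[OF range]] by (intro mult_right_mono) auto
        finally show "\<bar>(2 * s i - s (i + 1) - s (i - 1)) -
            (2 * depth_profile n i - depth_profile n (i + 1) - depth_profile n (i - 1))\<bar> \<le>
            \<epsilon> * (2 * depth_profile n i - depth_profile n (i + 1) - depth_profile n (i - 1))"
          unfolding Ls[OF range] Lg[OF range] by (simp add: mult_ac)
      }
      assume range: "0 < i" "i < n + 1"
      note w = weight_bounds[OF pos[OF range]] and c = curvature_bounds[OF pos[OF range]]
      show "0 \<le> 2 * depth_profile n i - depth_profile n (i + 1) - depth_profile n (i - 1)"
        unfolding Lg[OF range] using w c depth_const_pos by simp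
      have "depth_const * curvature i j \<le> depth_const * 1"
        using c depth_const_pos by (intro mult_left_mono) auto
      moreover have "0 < depth_const * curvature i j" using c depth_const_pos by simp
      ultimately have "\<bar>split_ratio i j - depth_const * curvature i j\<bar> \<le> B + depth_const"
        using B[of i j] by linarith
      then have "\<bar>split_ratio i j - depth_const * curvature i j\<bar> * weight i j \<le> C"
        unfolding C_def using w \<open>B \<ge> 0\<close> depth_const_pos by (intro mult_mono) auto
      then show "\<bar>(2 * s i - s (i + 1) - s (i - 1)) -
            (2 * depth_profile n i - depth_profile n (i + 1) - depth_profile n (i - 1))\<bar> \<le> C"
        unfolding Ls[OF range] Lg[OF range]
        using w(1) by (simp add: abs_mult flip: left_diff_distrib)
    qed (use assms \<open>C \<ge> 0\<close> that in auto)
    then show ?thesis using average_depth_eq[OF that] by (simp add: s_def)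
  qed
  then show thesis by (rule that)
qed

text \<open>
  The profile tends to infinity along \<open>r\<close>, so the constant error is negligible. Up to a factor
  tending to \<open>1\<close>, replacing \<open>n + 1\<close> by \<open>n\<close> in the profile gives the stated form.
\<close>

lemma average_depth_far:
  fixes r :: "nat \<Rightarrow> nat"
  assumes r: "filterlim r at_top sequentially" and nr: "filterlim (\<lambda>n. n - r n) at_top sequentially"
  shows "(\<lambda>n. average_depth n (r n)) \<sim>[sequentially]
     (\<lambda>n. 8 / sqrt (3 * pi) * sqrt (real (r n) * (1 - real (r n) / real n)))"
proof (rule asymp_equivI')
  have ev: "\<forall>\<^sub>F n in sequentially. 0 < r n \<and> r n < n"
    using filterlim_at_top[THEN iffD1, OF r, rule_format, of 1]
      filterlim_at_top[THEN iffD1, OF nr, rule_format, of 1]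
    by eventually_elim auto
  have inv_r: "(\<lambda>n. 1 / real (r n)) \<longlonglongrightarrow> 0"
    by (rule filterlim_compose[OF lim_1_over_n r])
  have inv_nr: "(\<lambda>n. 1 / real (n - r n)) \<longlonglongrightarrow> 0"
    by (rule filterlim_compose[OF lim_1_over_n nr])
  have nr1: "filterlim (\<lambda>n. n + 1 - r n) at_top sequentially"
    by (rule filterlim_at_top_mono[OF nr always_eventually]) (intro allI diff_le_mono le_add1)
  have inv_nr1: "(\<lambda>n. 1 / real (n + 1 - r n)) \<longlonglongrightarrow> 0"
    by (rule filterlim_compose[OF lim_1_over_n nr1])
  let ?g = "\<lambda>n. depth_profile n (r n)"
  have g_pos: "\<forall>\<^sub>F n in sequentially. ?g n > 0"
    using ev by eventually_elim (auto simp: depth_profile_def depth_const_pos)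
  have g_top: "filterlim ?g at_top sequentially"
  proof -
    \<comment> \<open>Up to the constant, the square of the profile is half the harmonic mean of \<open>r\<close> and \<open>n + 1 - r\<close>.\<close>
    have "(\<lambda>n. 1 / real (r n) + 1 / real (n + 1 - r n)) \<longlonglongrightarrow> 0"
      using tendsto_add[OF inv_r inv_nr1] by simp
    then have "filterlim (\<lambda>n. inverse (1 / real (r n) + 1 / real (n + 1 - r n))) at_top sequentially"
    proof (rule filterlim_inverse_at_top)
      show "\<forall>\<^sub>F n in sequentially. 0 < 1 / real (r n) + 1 / real (n + 1 - r n)"
        using ev by eventually_elim (auto intro: add_pos_nonneg)
    qed
    then have "filterlim (\<lambda>n. depth_const * sqrt (inverse (1 / real (r n) + 1 / real (n + 1 - r n))))
        at_top sequentially"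
      by (intro filterlim_tendsto_pos_mult_at_top[OF tendsto_const depth_const_pos]
          filterlim_compose[OF sqrt_at_top])
    moreover have "\<forall>\<^sub>F n in sequentially.
        depth_const * sqrt (inverse (1 / real (r n) + 1 / real (n + 1 - r n))) \<le> ?g n"
      using ev
    proof eventually_elim
      case (elim n)
      then have "inverse (1 / real (r n) + 1 / real (n + 1 - r n)) =
          real (r n) * real (n + 1 - r n) / real (n + 1)"
        by (simp add: field_simps of_nat_diff)
      then show ?case by (simp add: depth_profile_def)
    qed
    ultimately show ?thesis by (rule filterlim_at_top_mono)
  qed
  have "(\<lambda>n. average_depth n (r n) / ?g n) \<longlonglongrightarrow> 1"
  proof (rule LIMSEQ_I)
    fix e :: real assume "e > 0"
    obtain D where D: "\<And>n k. k \<le> n \<Longrightarrow>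
        \<bar>average_depth n k - depth_profile n k\<bar> \<le> e / 2 * depth_profile n k + D"
      using average_depth_near_profile[of "e / 2"] \<open>e > 0\<close> by auto
    have "\<forall>\<^sub>F n in sequentially. ?g n > 2 * D / e"
      using g_top by (simp add: filterlim_at_top_dense)
    then have "\<forall>\<^sub>F n in sequentially. norm (average_depth n (r n) / ?g n - 1) < e"
      using ev g_pos
    proof eventually_elim
      case (elim n)
      have "D < e / 2 * ?g n" using elim(1) \<open>e > 0\<close> by (simp add: field_simps)
      then have "\<bar>average_depth n (r n) - ?g n\<bar> < e * ?g n" using D[of "r n" n] elim(2) by auto
      moreover have "average_depth n (r n) / ?g n - 1 = (average_depth n (r n) - ?g n) / ?g n"
        using elim(3) by (simp add: diff_divide_distrib)
      ultimately show ?case using elim(3) by (simp add: abs_divide divide_less_eq)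
    qed
    then show "\<exists>no. \<forall>n\<ge>no. norm (average_depth n (r n) / ?g n - 1) < e"
      by (simp add: eventually_sequentially)
  qed
  moreover have "(\<lambda>n. sqrt ((1 + 1 / real (n - r n)) * (real n / (real n + 1)))) \<longlonglongrightarrow> 1"
  proof -
    have "(\<lambda>n. real n / (real n + 1)) \<longlonglongrightarrow> 1" by real_asymp
    from tendsto_real_sqrt[OF tendsto_mult[OF tendsto_add[OF tendsto_const[of 1] inv_nr] this]]
    show ?thesis by simp
  qed
  ultimately have lim: "(\<lambda>n. average_depth n (r n) / ?g n *
      sqrt ((1 + 1 / real (n - r n)) * (real n / (real n + 1)))) \<longlonglongrightarrow> 1 * 1"
    by (rule tendsto_mult)
  have "\<forall>\<^sub>F n in sequentially. average_depth n (r n) / ?g n *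
      sqrt ((1 + 1 / real (n - r n)) * (real n / (real n + 1))) =
      average_depth n (r n) / (8 / sqrt (3 * pi) * sqrt (real (r n) * (1 - real (r n) / real n)))"
    using ev g_pos
  proof eventually_elim
    case (elim n)
    define m where "m = n - r n"
    have n: "real n = real (r n) + real m" "real (n + 1 - r n) = real m + 1" "real (n + 1) = real n + 1"
      and pos: "real (r n) > 0" "real m > 0" "real n > 0"
      using elim(1) by (auto simp: m_def of_nat_diff)
    have "real (r n) * (real m + 1) / (real n + 1) =
        (real (r n) * (1 - real (r n) / real n)) * ((1 + 1 / real m) * (real n / (real n + 1)))"
    proof -
      have "1 - real (r n) / real n = real m / real n" using pos n(1) by (simp add: field_simps)
      moreover have "1 + 1 / real m = (real m + 1) / real m" using pos by (simp add: field_simps)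
      ultimately show ?thesis using pos by simp
    qed
    then have "?g n = 8 / sqrt (3 * pi) * sqrt (real (r n) * (1 - real (r n) / real n)) *
        sqrt ((1 + 1 / real m) * (real n / (real n + 1)))"
      unfolding depth_profile_def n(2,3) depth_const_def by (simp only: real_sqrt_mult mult.assoc)
    moreover have "sqrt ((1 + 1 / real m) * (real n / (real n + 1))) > 0"
      unfolding real_sqrt_gt_0_iff using pos by (intro mult_pos_pos divide_pos_pos add_pos_pos) auto
    moreover have "a / (T * c) * c = a / T" if "c > 0" for a T c :: real using that by simp
    ultimately show ?case unfolding m_def by metis
  qed
  from Lim_transform_eventually[OF lim this]
  show "(\<lambda>n. average_depth n (r n) / (8 / sqrt (3 * pi) * sqrt (real (r n) * (1 - real (r n) / real n))))
      \<longlonglongrightarrow> 1" by simp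
qed

theorem theorem6p2:
  shows "(\<forall>r::nat. 1 \<le> r \<longrightarrow>
            (\<lambda>n. average_depth n r) \<longlonglongrightarrow>
              2 * real r - 6 * (\<Sum>i = 1..r - 1. real (r - i) * t' (i - 1) * (4 ^ i / 27 ^ i)))
       \<and> (\<forall>r::nat \<Rightarrow> nat.
            (\<forall>\<^sub>F n in sequentially. 1 \<le> r n \<and> r n \<le> n) \<and>
            filterlim r at_top sequentially \<and>
            filterlim (\<lambda>n. n - r n) at_top sequentially \<longrightarrow>
            (\<lambda>n. average_depth n (r n)) \<sim>[sequentially]
              (\<lambda>n. 8 / sqrt (3 * pi) * sqrt (real (r n) * (1 - real (r n) / real n))))"
  using average_depth_fixed average_depth_far by blast

end
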